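(* Let $G$ be a finite group. If $\mathrm{anz}(G) < \frac{1}{3}$, then $G$ is nilpotent.
   Context: For a finite group $G$, $\mathrm{Irr}(G)$ denotes the set of complex irreducible characters of $G$. $\mathrm{nz}(G)$ denotes the number of zeros in the character table of $G$, i.e. the number of pairs $(\chi, C)$ with $\chi\in\mathrm{Irr}(G)$ and $C$ a conjugacy class of $G$ such that $\chi$ is $0$ on $C$. The average number of zeros of characters of $G$ is $\mathrm{anz}(G) := \mathrm{nz}(G)/|\mathrm{Irr}(G)|$. *)

theory Defs
  imports
    "HOL-Algebra.Group_Action"
    "HOL-Algebra.Generated_Groups"
    "Jordan_Normal_Form.VS_Connect"
begin

section \<open>Complex matrix representations and characters\<close>

definition GL :: "nat \<Rightarrow> complex mat monoid" where
  "GL n = units_of (ring_mat TYPE(complex) n ())"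

definition mat_trace :: "'a :: comm_monoid_add mat \<Rightarrow> 'a" where
  "mat_trace A = (\<Sum>i<dim_row A. A $$ (i, i))"

definition irreducible_rep ::
    "('g, 'b) monoid_scheme \<Rightarrow> nat \<Rightarrow> ('g \<Rightarrow> complex mat) \<Rightarrow> bool" where
  "irreducible_rep G n \<rho> \<longleftrightarrow>
     \<rho> \<in> hom G (GL n) \<and> n > 0 \<and>
     (\<forall>W. subspace class_ring W (module_vec TYPE(complex) n) \<longrightarrow>
          (\<forall>g\<in>carrier G. \<forall>w\<in>W. \<rho> g *\<^sub>v w \<in> W) \<longrightarrow>
          W = {0\<^sub>v n} \<or> W = carrier_vec n)"

text \<open>Characters are restricted to the carrier (they are \<^const>\<open>undefined\<close> outside it), so that
  two of them are equal exactly when they agree on the group.\<close>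

definition character :: "('g, 'b) monoid_scheme \<Rightarrow> ('g \<Rightarrow> complex mat) \<Rightarrow> 'g \<Rightarrow> complex" where
  "character G \<rho> = (\<lambda>g\<in>carrier G. mat_trace (\<rho> g))"

definition Irr :: "('g, 'b) monoid_scheme \<Rightarrow> ('g \<Rightarrow> complex) set" where
  "Irr G = {character G \<rho> | n \<rho>. irreducible_rep G n \<rho>}"

definition conjugacy_classes :: "('g, 'b) monoid_scheme \<Rightarrow> 'g set set" where
  "conjugacy_classes G =
     orbits G (carrier G) (\<lambda>g. \<lambda>h \<in> carrier G. g \<otimes>\<^bsub>G\<^esub> h \<otimes>\<^bsub>G\<^esub> inv\<^bsub>G\<^esub> g)"

section \<open>Zeros in the character table\<close>

definition nz :: "('g, 'b) monoid_scheme \<Rightarrow> nat" where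
  "nz G = card {(\<chi>, C). \<chi> \<in> Irr G \<and> C \<in> conjugacy_classes G \<and> (\<forall>g\<in>C. \<chi> g = 0)}"

definition anz :: "('g, 'b) monoid_scheme \<Rightarrow> real" where
  "anz G = real (nz G) / real (card (Irr G))"

section \<open>Nilpotent groups\<close>

definition commutator_subgroup :: "('g, 'b) monoid_scheme \<Rightarrow> 'g set \<Rightarrow> 'g set \<Rightarrow> 'g set" where
  "commutator_subgroup G H K =
     generate G {h \<otimes>\<^bsub>G\<^esub> k \<otimes>\<^bsub>G\<^esub> inv\<^bsub>G\<^esub> h \<otimes>\<^bsub>G\<^esub> inv\<^bsub>G\<^esub> k | h k. h \<in> H \<and> k \<in> K}"

fun lower_central_series :: "('g, 'b) monoid_scheme \<Rightarrow> nat \<Rightarrow> 'g set" where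
  "lower_central_series G 0 = carrier G"
| "lower_central_series G (Suc n) =
     commutator_subgroup G (lower_central_series G n) (carrier G)"

definition nilpotent :: "('g, 'b) monoid_scheme \<Rightarrow> bool" where
  "nilpotent G \<longleftrightarrow> (\<exists>n. lower_central_series G n = {\<one>\<^bsub>G\<^esub>})"

end

theory Submission
  imports Defs
    "HOL-Library.Function_Algebras"
    "HOL-Number_Theory.Totient"
    "HOL-Algebra.Multiplicative_Group"
    "Jordan_Normal_Form.Spectral_Radius"
begin

text \<open>A finite group with a nonlinear irreducible character has \<open>anz \<ge> 1/3\<close>, so the hypothesis even forces
  the group to be abelian. Let \<open>a\<close> and \<open>b\<close> be the numbers of linear and of nonlinear irreducible
  characters. By Burnside's theorem every nonlinear character has a zero, so there are at least \<open>b\<close>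
  zeros. Fix a nonlinear \<open>\<chi>\<close>. If the products \<open>\<eta>\<chi>\<close> with \<open>\<eta>\<close> linear are distinct, then \<open>b \<ge> a\<close>. Otherwise
  \<open>\<eta>\<chi> = \<mu>\<chi>\<close> for some \<open>\<eta> \<noteq> \<mu>\<close>, and \<open>\<chi>\<close> vanishes off the proper subgroup on which \<open>\<eta>\<close> and \<open>\<mu>\<close> agree,
  that is on at least half of the group; every conjugacy class lies in a coset of the common kernel
  \<open>D\<close> of the linear characters and \<open>a \<bar>D\<bar> \<le> \<bar>G\<bar>\<close>, so these are at least \<open>a/2\<close> classes. In both cases there
  are at least \<open>max b (a/2) \<ge> (a + b)/3\<close> zeros.\<close>

section \<open>Sums of roots of unity\<close>

lemma sum_cis_powers:
  fixes N k :: nat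
  assumes "N > 0"
  shows "(\<Sum>i<N. cis (2 * pi * real k / real N) ^ i) \<in> \<int>"
proof -
  define w where "w = cis (2 * pi * real k / real N)"
  have wN: "w ^ N = 1"
    using assms by (simp add: w_def DeMoivre cis_multiple_2pi)
  show ?thesis
  proof (cases "w = 1")
    case True
    then show ?thesis by (simp add: w_def[symmetric])
  next
    case False
    then have "(\<Sum>i<N. w ^ i) = 0" by (simp add: geometric_sum wN)
    then show ?thesis by (simp add: w_def[symmetric])
  qed
qed

text \<open>Sorting the exponents from 1 to \<open>N\<close> by their gcd with \<open>N\<close>
  splits the full geometric sum into one such sum for each divisor of \<open>N\<close>. The full sum
  is an integer, and so by induction are the parts belonging to proper divisors; the part for
  \<open>N\<close> itself remains. It is the trace, from the \<open>N\<close>th cyclotomic field to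
  the rationals, of an \<open>N\<close>th root of unity.\<close>

lemma ramanujan_sum_Ints:
  fixes N k :: nat
  assumes "N > 0"
  shows "(\<Sum>i\<in>totatives N. cis (2 * pi * real k / real N) ^ i) \<in> \<int>"
  using assms
proof (induction N rule: less_induct)
  case (less N)
  define c where "c d = (\<Sum>i\<in>totatives d. cis (2 * pi * real k / real d) ^ i)" for d
  \<comment> \<open>The exponent 0 is traded for \<open>N\<close>, because \<open>totatives\<close>
    are taken from \<open>{0<..N}\<close>.\<close>
  have "(\<Sum>i<N. cis (2 * pi * real k / real N) ^ i) = (\<Sum>i\<in>{0<..N}. cis (2 * pi * real k / real N) ^ i)"
  proof -
    have "{..<N} = insert 0 {0<..<N}" "{0<..N} = insert N {0<..<N}" using less.prems by auto
    moreover have "cis (2 * pi * real k / real N) ^ N = 1"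
      using less.prems by (simp add: DeMoivre cis_multiple_2pi)
    ultimately show ?thesis by simp
  qed
  also have "\<dots> = (\<Sum>d | d dvd N. \<Sum>i | i \<in> {0<..N} \<and> gcd i N = d. cis (2 * pi * real k / real N) ^ i)"
    using less.prems
    by (subst sum.group[symmetric, where T = "{d. d dvd N}" and g = "\<lambda>i. gcd i N"]) auto
  also have "\<dots> = (\<Sum>d | d dvd N. c (N div d))"
  proof (rule sum.cong)
    fix d assume d: "d \<in> {d. d dvd N}"
    then obtain e where e: "N = d * e" by auto
    with less.prems have pos: "d > 0" "e > 0" by auto
    have "(\<Sum>i | i \<in> {0<..N} \<and> gcd i N = d. cis (2 * pi * real k / real N) ^ i) = c e"
      using sum.reindex_bij_betw[OF bij_betw_totatives_gcd_eq[of d N],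
          of "\<lambda>i. cis (2 * pi * real k / real N) ^ i"] e pos less.prems
      by (simp add: c_def DeMoivre mult_ac)
    then show "(\<Sum>i | i \<in> {0<..N} \<and> gcd i N = d. cis (2 * pi * real k / real N) ^ i) = c (N div d)"
      using e pos by simp
  qed simp
  also have "\<dots> = c N + (\<Sum>d | d dvd N \<and> d \<noteq> 1. c (N div d))"
  proof -
    have "{d. d dvd N} = insert 1 {d. d dvd N \<and> d \<noteq> 1}" by auto
    moreover have "finite {d. d dvd N \<and> d \<noteq> 1}" using less.prems by simp
    ultimately show ?thesis by simp
  qed
  finally have eq: "c N = (\<Sum>i<N. cis (2 * pi * real k / real N) ^ i) - (\<Sum>d | d dvd N \<and> d \<noteq> 1. c (N div d))"
    by (simp add: algebra_simps)
  have "(\<Sum>d | d dvd N \<and> d \<noteq> 1. c (N div d)) \<in> \<int>"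
  proof (rule Ints_sum)
    fix d assume "d \<in> {d. d dvd N \<and> d \<noteq> 1}"
    then have d: "d dvd N" "d \<noteq> 1" by auto
    with less.prems have "d > 1" by (cases d) (auto simp: Suc_lessI)
    with d less.prems have "N div d < N" "N div d > 0"
      by (simp_all add: div_greater_zero_iff dvd_imp_le)
    then show "c (N div d) \<in> \<int>" using less.IH unfolding c_def by blast
  qed
  then have "c N \<in> \<int>"
    unfolding eq by (intro Ints_diff sum_cis_powers[OF less.prems])
  then show ?case by (simp only: c_def)
qed

text \<open>For \<open>j\<close> coprime to \<open>N\<close> this is the image of the cyclotomic
  integer \<open>root_sum N es 1\<close> under the Galois automorphism raising \<open>N\<close>th
  roots of unity to the \<open>j\<close>th power. The integer is represented by its list of
  exponents, so conjugation becomes a mere change of \<open>j\<close>.\<close>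

definition root_sum :: "nat \<Rightarrow> nat list \<Rightarrow> nat \<Rightarrow> complex" where
  "root_sum N es j = (\<Sum>e\<leftarrow>es. cis (2 * pi * real e / real N) ^ j)"

lemma root_sum_mult:
  "root_sum N es j * root_sum N fs j = root_sum N (concat (map (\<lambda>e. map ((+) e) fs) es)) j"
proof (induction es)
  case (Cons e es)
  have "root_sum N (map ((+) e) fs) j = cis (2 * pi * real e / real N) ^ j * root_sum N fs j"
    by (simp add: root_sum_def sum_list_const_mult[symmetric] o_def cis_mult power_mult_distrib[symmetric]
          ring_distribs add_divide_distrib)
  with Cons show ?case by (simp add: root_sum_def algebra_simps)
qed (simp add: root_sum_def)

lemma root_sum_dilate: "root_sum N es (i * j) = root_sum N (map ((*) j) es) i"
  by (simp add: root_sum_def o_def DeMoivre mult_ac)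

text \<open>One list \<open>fs\<close> serves all \<open>j\<close> at once; this is the fact that
  Galois conjugation commutes with products.\<close>

lemma root_sum_prod:
  assumes "finite J"
  shows "\<exists>fs. \<forall>j. (\<Prod>a\<in>J. root_sum N (es a) j) = root_sum N fs j"
  using assms
proof (induction J)
  case empty
  have "1 = root_sum N [0] j" for j by (simp add: root_sum_def)
  then show ?case by auto
next
  case (insert a J)
  then obtain fs where "\<forall>j. (\<Prod>a\<in>J. root_sum N (es a) j) = root_sum N fs j" by blast
  with insert.hyps show ?case by (auto simp: root_sum_mult)
qed

lemma root_sum_power: "\<exists>fs. \<forall>j. root_sum N es j ^ m = root_sum N fs j"
  using root_sum_prod[of "{..<m}" N "\<lambda>_. es"] by simp

lemma root_sum_mod:
  assumes "N > 0" shows "root_sum N es (j mod N) = root_sum N es j"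
proof -
  have "cis (2 * pi * real e / real N) ^ (j mod N) = cis (2 * pi * real e / real N) ^ j" for e
  proof -
    let ?w = "cis (2 * pi * real e / real N)"
    have "?w ^ j = ?w ^ (N * (j div N) + j mod N)" by simp
    also have "\<dots> = (?w ^ N) ^ (j div N) * ?w ^ (j mod N)" by (simp only: power_add power_mult)
    also have "?w ^ N = 1" using assms by (simp add: DeMoivre cis_multiple_2pi)
    finally show ?thesis by simp
  qed
  then show ?thesis by (simp add: root_sum_def)
qed

lemma sum_totatives_root_sum_Ints:
  assumes "N > 0" shows "(\<Sum>i\<in>totatives N. root_sum N es i) \<in> \<int>"
proof (induction es)
  case (Cons e es)
  then show ?case using ramanujan_sum_Ints[OF assms, of e]
    by (simp add: root_sum_def sum.distrib)
qed (simp add: root_sum_def)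

text \<open>Multiplication by the unit \<open>i\<close> permutes the units modulo \<open>N\<close>,
  so a product over all Galois conjugates is fixed by each conjugation.\<close>

lemma prod_totatives_mult:
  assumes "i \<in> totatives N" "N > 1" and per: "\<And>j. f (j mod N) = f j"
  shows "(\<Prod>j\<in>totatives N. f (i * j)) = (\<Prod>j\<in>totatives N. f j :: complex)"
proof -
  have inj: "inj_on (\<lambda>j. i * j mod N) (totatives N)"
  proof (rule inj_onI)
    fix a b assume ab: "a \<in> totatives N" "b \<in> totatives N" "i * a mod N = i * b mod N"
    from assms have "coprime i N" by (auto simp: totatives_def)
    with ab have "[a = b] (mod N)" by (simp add: cong_def[symmetric] cong_mult_lcancel_nat)
    with ab assms show "a = b"
      by (metis cong_less_modulus_unique_nat totatives_less)
  qed
  have sub: "(\<lambda>j. i * j mod N) ` totatives N \<subseteq> totatives N"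
  proof
    fix x assume "x \<in> (\<lambda>j. i * j mod N) ` totatives N"
    then obtain j where j: "j \<in> totatives N" "x = i * j mod N" by auto
    then have "coprime x N" using assms by (auto simp: totatives_def)
    moreover have "x < N" using j assms by simp
    moreover have "x > 0" using \<open>coprime x N\<close> assms by (cases "x = 0") auto
    ultimately show "x \<in> totatives N" by (auto simp: totatives_def)
  qed
  have "bij_betw (\<lambda>j. i * j mod N) (totatives N) (totatives N)"
    using inj sub by (simp add: bij_betw_def endo_inj_surj)
  from prod.reindex_bij_betw[OF this, of f] show ?thesis by (simp add: per)
qed

text \<open>With \<open>R\<close> the product in question, the averages of \<open>R ^ m\<close> over the Galois conjugates show
  that \<open>totient N * R ^ m\<close> is an integer for every \<open>m\<close>; this replaces the theory of algebraic
  integers.\<close>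
lemma norm_prod_root_sum_ge_1:
  assumes N: "N > 1" and nz: "\<And>j. j \<in> totatives N \<Longrightarrow> root_sum N es j \<noteq> 0"
  shows "norm (\<Prod>j\<in>totatives N. root_sum N es j) \<ge> 1"
proof (rule ccontr)
  define R where "R = (\<Prod>j\<in>totatives N. root_sum N es j)"
  assume "\<not> ?thesis"
  then have R1: "norm R < 1" by (simp add: R_def)
  have R0: "R \<noteq> 0" using nz by (simp add: R_def)
  have int: "of_nat (totient N) * R ^ m \<in> \<int>" for m
  proof -
    obtain fs where fs: "\<And>i. (\<Prod>j\<in>totatives N. root_sum N (map ((*) j) es) i) = root_sum N fs i"
      using root_sum_prod[of "totatives N" N "\<lambda>j. map ((*) j) es"] by auto
    obtain gs where gs: "\<And>i. root_sum N fs i ^ m = root_sum N gs i"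
      using root_sum_power[of N fs m] by auto
    \<comment> \<open>Every conjugate of \<open>R ^ m\<close> is \<open>R ^ m\<close> again, so
      summing over the conjugates multiplies it by \<open>totient N\<close>.\<close>
    have "root_sum N gs i = R ^ m" if "i \<in> totatives N" for i
      using prod_totatives_mult[OF that N, of "root_sum N es"] N
      by (simp add: gs[symmetric] fs[symmetric] R_def root_sum_dilate[symmetric] root_sum_mod)
    then have "(\<Sum>i\<in>totatives N. root_sum N gs i) = of_nat (totient N) * R ^ m"
      by (simp add: totient_def)
    then show ?thesis using sum_totatives_root_sum_Ints[of N gs] N by simp
  qed
  have tot: "totient N > 0" using N by simp
  \<comment> \<open>With \<open>norm R < 1\<close> the integers
    \<open>of_nat (totient N) * R ^ m\<close> tend to 0, so one of them is 0, although neither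
    factor vanishes.\<close>
  have "(\<lambda>m. of_nat (totient N) * norm R ^ m) \<longlonglongrightarrow> of_nat (totient N) * 0"
    by (intro tendsto_intros LIMSEQ_power_zero) (simp add: R1)
  then have "eventually (\<lambda>m. of_nat (totient N) * norm R ^ m < 1) sequentially"
    by (auto dest: order_tendstoD(2)[where a = 1])
  then obtain m where "of_nat (totient N) * norm R ^ m < 1"
    by (auto simp: eventually_sequentially)
  then have "norm (of_nat (totient N) * R ^ m) < 1" by (simp add: norm_mult norm_power)
  with int[of m] have "of_nat (totient N) * R ^ m = 0"
    by (metis Ints_cases norm_of_int of_int_abs of_int_less_1_iff abs_ge_zero zabs_less_one_iff of_int_0)
  then show False using tot R0 by simp
qed

section \<open>Traces and Schur's lemma\<close>

lemma mat_trace_mult_comm: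
  fixes A :: "'a :: comm_semiring_0 mat"
  assumes "A \<in> carrier_mat n m" "B \<in> carrier_mat m n"
  shows "mat_trace (A * B) = mat_trace (B * A)"
proof -
  have "mat_trace (A * B) = (\<Sum>i<n. \<Sum>j<m. A $$ (i, j) * B $$ (j, i))"
    using assms by (simp add: mat_trace_def scalar_prod_def lessThan_atLeast0)
  also have "\<dots> = (\<Sum>j<m. \<Sum>i<n. B $$ (j, i) * A $$ (i, j))"
    by (subst sum.swap) (simp add: mult.commute)
  also have "\<dots> = mat_trace (B * A)"
    using assms by (simp add: mat_trace_def scalar_prod_def lessThan_atLeast0)
  finally show ?thesis .
qed

lemma mat_eqI_mult_vec:
  fixes A B :: "'a :: semiring_1 mat"
  assumes A: "A \<in> carrier_mat n m" and B: "B \<in> carrier_mat n m"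
    and eq: "\<And>v. v \<in> carrier_vec m \<Longrightarrow> A *\<^sub>v v = B *\<^sub>v v"
  shows "A = B"
proof (rule eq_matI)
  fix i j assume ij: "i < dim_row B" "j < dim_col B"
  have "(A *\<^sub>v unit_vec m j) $ i = (B *\<^sub>v unit_vec m j) $ i" using eq by simp
  then show "A $$ (i, j) = B $$ (i, j)"
    using ij A B by (simp add: scalar_prod_right_unit)
qed (use A B in auto)

lemma mult_mat_zero_vec:
  fixes A :: "'a :: semiring_0 mat"
  assumes "A \<in> carrier_mat n m" shows "A *\<^sub>v 0\<^sub>v m = 0\<^sub>v n"
  by (rule eq_vecI) (use assms in auto)

lemma upper_triangular_pow:
  fixes B :: "'a :: semiring_1 mat"
  assumes B: "B \<in> carrier_mat n n" and ut: "upper_triangular B"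
  shows "upper_triangular (B ^\<^sub>m k) \<and> (\<forall>i<n. (B ^\<^sub>m k) $$ (i, i) = B $$ (i, i) ^ k)"
proof (induction k)
  case 0
  then show ?case using B by (auto simp: upper_triangular_def)
next
  case (Suc k)
  let ?C = "B ^\<^sub>m k"
  have C: "?C \<in> carrier_mat n n" using B by simp
  \<comment> \<open>On and below the diagonal only the summand with \<open>l = i = j\<close>
    survives: for \<open>l < i\<close> the entry of \<open>?C\<close> is 0, for \<open>j < l\<close>
    that of \<open>B\<close>.\<close>
  have zero: "?C $$ (i, l) * B $$ (l, j) = 0" if "i < n" "l < n" "j \<le> i" "l \<noteq> i \<or> j < i" for i j l
  proof (cases "l < i")
    case True
    then show ?thesis using Suc C that by (auto simp: upper_triangular_def)
  next
    case False
    then have "j < l" using that by auto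
    then show ?thesis using ut B that by (auto simp: upper_triangular_def)
  qed
  have entry: "(?C * B) $$ (i, j) = (\<Sum>l\<in>{0..<n}. ?C $$ (i, l) * B $$ (l, j))" if "i < n" "j < n" for i j
    using that C B by (simp add: scalar_prod_def)
  have "(?C * B) $$ (i, j) = 0" if "i < n" "j < i" for i j
    using that zero by (subst entry) (auto intro!: sum.neutral)
  moreover have "(?C * B) $$ (i, i) = B $$ (i, i) ^ Suc k" if "i < n" for i
  proof -
    have "(?C * B) $$ (i, i) = (\<Sum>l\<in>{i}. ?C $$ (i, l) * B $$ (l, i))"
      unfolding entry[OF that that]
      by (rule sum.mono_neutral_right) (use that zero in auto)
    then show ?thesis using Suc that by (simp add: power_commutes)
  qed
  ultimately show ?case using C B by (auto simp: upper_triangular_def)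
qed

text \<open>\<open>A\<close> is similar to a triangular matrix \<open>B\<close> with
  \<open>B ^\<^sub>m N = 1\<^sub>m n\<close>. The diagonal entries of \<open>B\<close> are therefore
  \<open>N\<close>th roots of unity, and those of its powers are their powers; one list of exponents
  thus gives the traces of all powers of \<open>A\<close>.\<close>

lemma mat_trace_pow_root_sum:
  fixes A :: "complex mat"
  assumes A: "A \<in> carrier_mat n n" and N: "N > 0" and one: "A ^\<^sub>m N = 1\<^sub>m n"
  obtains es where "\<And>j. mat_trace (A ^\<^sub>m j) = root_sum N es j"
proof -
  from char_poly_factorized[OF A] obtain as where "char_poly A = (\<Prod>a\<leftarrow>as. [:- a, 1:])" by auto
  from schur_decomposition_exists[OF A this] obtain B P Q where
    ut: "upper_triangular B" and wit: "similar_mat_wit A B P Q" by (auto simp: similar_mat_def)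
  note w = similar_mat_witD2[OF A wit]
  have tr: "mat_trace (A ^\<^sub>m j) = mat_trace (B ^\<^sub>m j)" for j
  proof -
    have "A ^\<^sub>m j = P * (B ^\<^sub>m j * Q)"
      unfolding similar_mat_wit_pow_id[OF wit] using w(4-7) by (simp add: assoc_mult_mat[of _ n n _ n _ n])
    then have "mat_trace (A ^\<^sub>m j) = mat_trace ((B ^\<^sub>m j * Q) * P)"
      using mat_trace_mult_comm[OF w(6) mult_carrier_mat[OF pow_carrier_mat[OF w(5)] w(7)]] by simp
    also have "(B ^\<^sub>m j * Q) * P = B ^\<^sub>m j"
      using w(2,4-7) by (simp add: assoc_mult_mat[of _ n n _ n _ n])
    finally show ?thesis .
  qed
  have BN: "B ^\<^sub>m N = 1\<^sub>m n"
  proof -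
    have "B ^\<^sub>m N = Q * A ^\<^sub>m N * P"
      using similar_mat_wit_pow_id[OF similar_mat_wit_sym[OF wit]] .
    then show ?thesis using w(2,4-7) one by simp
  qed
  have "\<exists>e. cis (2 * pi * real e / real N) = B $$ (i, i)" if "i < n" for i
  proof -
    have "B $$ (i, i) ^ N = 1" using upper_triangular_pow[OF w(5) ut, of N] BN that by auto
    then have "B $$ (i, i) \<in> (\<lambda>k. cis (2 * pi * real k / real N)) ` {..<N}"
      using bij_betw_imp_surj_on[OF bij_betw_roots_unity[OF N]] by simp
    then show ?thesis by auto
  qed
  then obtain e where e: "\<And>i. i < n \<Longrightarrow> cis (2 * pi * real (e i) / real N) = B $$ (i, i)" by metis
  have "mat_trace (A ^\<^sub>m j) = root_sum N (map e [0..<n]) j" for j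
  proof -
    have "mat_trace (B ^\<^sub>m j) = (\<Sum>i<n. cis (2 * pi * real (e i) / real N) ^ j)"
      using w(5) upper_triangular_pow[OF w(5) ut, of j] e
      by (auto simp: mat_trace_def intro!: sum.cong)
    also have "\<dots> = root_sum N (map e [0..<n]) j"
      by (simp add: root_sum_def o_def interv_sum_list_conv_sum_set_nat lessThan_atLeast0)
    finally show ?thesis by (simp add: tr)
  qed
  then show thesis by (rule that)
qed

text \<open>On \<open>N\<close>th roots of unity the exponent \<open>N - 1\<close> acts as
  inversion, which is complex conjugation.\<close>

lemma root_sum_cnj:
  assumes "N > 0" shows "root_sum N es (N - 1) = cnj (root_sum N es 1)"
proof -
  have "cis (2 * pi * real e / real N) ^ (N - 1) = cnj (cis (2 * pi * real e / real N))" for e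
  proof -
    let ?w = "cis (2 * pi * real e / real N)"
    have "?w ^ (N - 1) * ?w = ?w ^ N"
      using assms by (metis Suc_diff_1 mult.commute power_Suc)
    also have "\<dots> = 1" using assms by (simp add: DeMoivre cis_multiple_2pi)
    finally have "?w ^ (N - 1) = inverse ?w" by (metis inverse_unique inverse_inverse_eq)
    then show ?thesis by (simp add: cis_cnj)
  qed
  then show ?thesis by (induction es) (simp_all add: root_sum_def)
qed

section \<open>Irreducible representations in matrix terms and Schur's lemma\<close>

lemma subspace_module_vec_iff:
  "VectorSpace.subspace class_ring W (module_vec TYPE(complex) n) \<longleftrightarrow>
     W \<subseteq> carrier_vec n \<and> 0\<^sub>v n \<in> W \<and> (\<forall>v\<in>W. \<forall>w\<in>W. v + w \<in> W) \<and> (\<forall>c. \<forall>v\<in>W. c \<cdot>\<^sub>v v \<in> W)"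
proof -
  interpret vec_space "TYPE(complex)" n .
  show ?thesis
    unfolding VectorSpace.subspace_def submodule_def
    using vectorspace_axioms module_axioms by (auto simp: module_vec_def)
qed

context group
begin

text \<open>For a multiplicative map sending \<open>\<one>\<close> to the identity matrix,
  invertibility is automatic, with \<open>\<rho> (inv g)\<close> as the inverse of
  \<open>\<rho> g\<close>. Conversely \<open>\<rho> \<one>\<close> is an invertible idempotent and
  hence the identity.\<close>

lemma hom_GL_iff:
  "\<rho> \<in> hom G (GL n) \<longleftrightarrow>
     (\<forall>g\<in>carrier G. \<rho> g \<in> carrier_mat n n) \<and>
     (\<forall>g\<in>carrier G. \<forall>h\<in>carrier G. \<rho> (g \<otimes> h) = \<rho> g * \<rho> h) \<and> \<rho> \<one> = 1\<^sub>m n"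
    (is "?L \<longleftrightarrow> ?R")
proof
  assume L: ?L
  then have c: "\<rho> g \<in> carrier_mat n n" if "g \<in> carrier G" for g
    using that by (auto simp: hom_def GL_def units_of_def Units_def ring_mat_def)
  have m: "\<rho> (g \<otimes> h) = \<rho> g * \<rho> h" if "g \<in> carrier G" "h \<in> carrier G" for g h
    using L that by (auto simp: hom_def GL_def units_of_def ring_mat_def)
  have "\<rho> \<one> \<in> Units (ring_mat TYPE(complex) n ())"
    using L by (auto simp: hom_def GL_def units_of_def)
  then obtain X where X: "X \<in> carrier_mat n n" "X * \<rho> \<one> = 1\<^sub>m n"
    unfolding Units_def ring_mat_def by auto
  have "\<rho> \<one> = X * \<rho> \<one> * \<rho> \<one>" using X c[of \<one>] by simp
  also have "\<dots> = X * (\<rho> \<one> * \<rho> \<one>)" by (rule assoc_mult_mat) (use X c[of \<one>] in auto)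
  also have "\<dots> = 1\<^sub>m n" using X m[of \<one> \<one>] by simp
  finally show ?R using c m by simp
next
  assume R: ?R
  have "\<rho> g \<in> carrier (GL n)" if "g \<in> carrier G" for g
  proof -
    have "\<rho> g * \<rho> (inv g) = 1\<^sub>m n" "\<rho> (inv g) * \<rho> g = 1\<^sub>m n"
      using R that by (metis inv_closed r_inv, metis inv_closed l_inv)
    then show ?thesis
      using R that unfolding GL_def units_of_def Units_def ring_mat_def by auto
  qed
  then show ?L using R by (auto simp: hom_def GL_def units_of_def ring_mat_def)
qed

lemma irreducible_rep_iff:
  "irreducible_rep G n \<rho> \<longleftrightarrow>
     (\<forall>g\<in>carrier G. \<rho> g \<in> carrier_mat n n) \<and>
     (\<forall>g\<in>carrier G. \<forall>h\<in>carrier G. \<rho> (g \<otimes> h) = \<rho> g * \<rho> h) \<and> \<rho> \<one> = 1\<^sub>m n \<and> n > 0 \<and>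
     (\<forall>W. W \<subseteq> carrier_vec n \<longrightarrow> 0\<^sub>v n \<in> W \<longrightarrow> (\<forall>v\<in>W. \<forall>w\<in>W. v + w \<in> W) \<longrightarrow>
          (\<forall>c. \<forall>v\<in>W. c \<cdot>\<^sub>v v \<in> W) \<longrightarrow> (\<forall>g\<in>carrier G. \<forall>w\<in>W. \<rho> g *\<^sub>v w \<in> W) \<longrightarrow>
          W = {0\<^sub>v n} \<or> W = carrier_vec n)"
  unfolding irreducible_rep_def hom_GL_iff subspace_module_vec_iff
  by (simp only: conj_assoc imp_conjL)

lemma irreducible_repD:
  assumes "irreducible_rep G n \<rho>"
  shows "g \<in> carrier G \<Longrightarrow> \<rho> g \<in> carrier_mat n n"
    and "g \<in> carrier G \<Longrightarrow> h \<in> carrier G \<Longrightarrow> \<rho> (g \<otimes> h) = \<rho> g * \<rho> h"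
    and "\<rho> \<one> = 1\<^sub>m n"
    and "n > 0"
proof -
  have "(\<forall>g\<in>carrier G. \<rho> g \<in> carrier_mat n n) \<and>
     (\<forall>g\<in>carrier G. \<forall>h\<in>carrier G. \<rho> (g \<otimes> h) = \<rho> g * \<rho> h) \<and> \<rho> \<one> = 1\<^sub>m n"
    and "n > 0"
    using assms unfolding irreducible_rep_def hom_GL_iff by argo+
  then show "g \<in> carrier G \<Longrightarrow> \<rho> g \<in> carrier_mat n n"
    and "g \<in> carrier G \<Longrightarrow> h \<in> carrier G \<Longrightarrow> \<rho> (g \<otimes> h) = \<rho> g * \<rho> h"
    and "\<rho> \<one> = 1\<^sub>m n"
    and "n > 0"
    by auto
qed

lemma irreducible_rep_subspace:
  assumes "irreducible_rep G n \<rho>"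
    and "W \<subseteq> carrier_vec n" "0\<^sub>v n \<in> W" "\<forall>v\<in>W. \<forall>w\<in>W. v + w \<in> W" "\<forall>c. \<forall>v\<in>W. c \<cdot>\<^sub>v v \<in> W"
    and "\<forall>g\<in>carrier G. \<forall>w\<in>W. \<rho> g *\<^sub>v w \<in> W"
  shows "W = {0\<^sub>v n} \<or> W = carrier_vec n"
  using assms unfolding irreducible_rep_iff by (elim conjE allE[of _ W] impE) assumption+

text \<open>The kernel \<open>K\<close> of \<open>T\<close> is invariant under
  \<open>\<sigma>\<close> and the image \<open>I\<close> under \<open>\<rho>\<close>. Irreducibility
  makes each of them zero or everything, so \<open>T\<close> is either zero or bijective.\<close>

lemma schur_intertwiner:
  assumes \<rho>: "irreducible_rep G n \<rho>" and \<sigma>: "irreducible_rep G m \<sigma>"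
    and T: "T \<in> carrier_mat n m"
    and inter: "\<And>g. g \<in> carrier G \<Longrightarrow> \<rho> g * T = T * \<sigma> g"
  shows "T = 0\<^sub>m n m \<or> (\<exists>S\<in>carrier_mat m n. T * S = 1\<^sub>m n \<and> S * T = 1\<^sub>m m)"
proof -
  have rc: "\<rho> g \<in> carrier_mat n n" and sc: "\<sigma> g \<in> carrier_mat m m" if "g \<in> carrier G" for g
    using irreducible_repD(1)[OF \<rho>] irreducible_repD(1)[OF \<sigma>] that by auto
  have inter_vec: "\<rho> g *\<^sub>v (T *\<^sub>v v) = T *\<^sub>v (\<sigma> g *\<^sub>v v)" if "g \<in> carrier G" "v \<in> carrier_vec m" for g v
    using inter[OF that(1)] rc sc that T
    by (metis assoc_mult_mat_vec)
  define K where "K = {v \<in> carrier_vec m. T *\<^sub>v v = 0\<^sub>v n}"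
  define I where "I = (\<lambda>v. T *\<^sub>v v) ` carrier_vec m"
  have "K = {0\<^sub>v m} \<or> K = carrier_vec m"
  proof -
    have "0\<^sub>v m \<in> K" using T by (auto simp: K_def)
    moreover have "\<forall>v\<in>K. \<forall>w\<in>K. v + w \<in> K"
      using T by (auto simp: K_def mult_add_distrib_mat_vec)
    moreover have "\<forall>c. \<forall>v\<in>K. c \<cdot>\<^sub>v v \<in> K"
      using T by (auto simp: K_def mult_mat_vec)
    moreover have "\<forall>g\<in>carrier G. \<forall>w\<in>K. \<sigma> g *\<^sub>v w \<in> K"
    proof (intro ballI)
      fix g w assume gw: "g \<in> carrier G" "w \<in> K"
      then have "\<sigma> g *\<^sub>v w \<in> carrier_vec m" using mult_mat_vec_carrier[OF sc] by (auto simp: K_def)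
      moreover have "T *\<^sub>v (\<sigma> g *\<^sub>v w) = 0\<^sub>v n"
        using gw inter_vec[of g w] mult_mat_zero_vec[OF rc[of g]] by (auto simp: K_def)
      ultimately show "\<sigma> g *\<^sub>v w \<in> K" by (simp add: K_def)
    qed
    moreover have "K \<subseteq> carrier_vec m" by (auto simp: K_def)
    ultimately show ?thesis by (intro irreducible_rep_subspace[OF \<sigma>])
  qed
  moreover have "I = {0\<^sub>v n} \<or> I = carrier_vec n"
  proof -
    have "0\<^sub>v n \<in> I" using T by (auto simp: I_def intro!: image_eqI[of _ _ "0\<^sub>v m"])
    moreover have "\<forall>v\<in>I. \<forall>w\<in>I. v + w \<in> I"
      using T by (auto simp: I_def mult_add_distrib_mat_vec[symmetric])
    moreover have "\<forall>c. \<forall>v\<in>I. c \<cdot>\<^sub>v v \<in> I"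
      using T by (auto simp: I_def mult_mat_vec[symmetric])
    moreover have "\<forall>g\<in>carrier G. \<forall>w\<in>I. \<rho> g *\<^sub>v w \<in> I"
    proof (intro ballI)
      fix g w assume gw: "g \<in> carrier G" "w \<in> I"
      then obtain v where v: "v \<in> carrier_vec m" "w = T *\<^sub>v v" by (auto simp: I_def)
      then have "\<sigma> g *\<^sub>v v \<in> carrier_vec m" using gw mult_mat_vec_carrier[OF sc] by auto
      then show "\<rho> g *\<^sub>v w \<in> I" using gw v inter_vec by (auto simp: I_def)
    qed
    moreover have "I \<subseteq> carrier_vec n" using T by (auto simp: I_def)
    ultimately show ?thesis by (intro irreducible_rep_subspace[OF \<rho>])
  qed
  moreover have zero: "T = 0\<^sub>m n m" if "\<forall>v\<in>carrier_vec m. T *\<^sub>v v = 0\<^sub>v n"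
    by (rule mat_eqI_mult_vec[OF T]) (use that in auto)
  moreover have "\<exists>S\<in>carrier_mat m n. T * S = 1\<^sub>m n \<and> S * T = 1\<^sub>m m"
    if K: "K = {0\<^sub>v m}" and I: "I = carrier_vec n"
  proof -
    \<comment> \<open>Preimages of the unit vectors are the columns of a right inverse
      \<open>S\<close>.\<close>
    have "\<forall>j<n. \<exists>v\<in>carrier_vec m. T *\<^sub>v v = unit_vec n j"
      using I unfolding I_def by (metis imageE unit_vec_carrier)
    then obtain w where w: "\<And>j. j < n \<Longrightarrow> w j \<in> carrier_vec m \<and> T *\<^sub>v w j = unit_vec n j" by metis
    define S where "S = mat m n (\<lambda>(i, j). w j $ i)"
    have S: "S \<in> carrier_mat m n" by (simp add: S_def)
    have colS: "col S j = w j" if "j < n" for j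
      by (rule eq_vecI) (use w[OF that] that in \<open>auto simp: S_def\<close>)
    have TS: "T * S = 1\<^sub>m n"
    proof (rule eq_matI)
      fix i j assume ij: "i < dim_row (1\<^sub>m n)" "j < dim_col (1\<^sub>m n :: complex mat)"
      then have "(T * S) $$ (i, j) = (T *\<^sub>v w j) $ i"
        using T S colS by simp
      then show "(T * S) $$ (i, j) = 1\<^sub>m n $$ (i, j)" using ij w by simp
    qed (use T S in auto)
    have "S * T = 1\<^sub>m m"
    proof (rule mat_eqI_mult_vec)
      fix v :: "complex vec" assume v: "v \<in> carrier_vec m"
      \<comment> \<open>Since \<open>T * S\<close> is the identity, \<open>T\<close> kills this
        difference; injectivity then makes \<open>S\<close> a left inverse too.\<close>
      let ?d = "S *\<^sub>v (T *\<^sub>v v) - v"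
      have Tv: "T *\<^sub>v v \<in> carrier_vec n" using T v by simp
      have STv: "S *\<^sub>v (T *\<^sub>v v) \<in> carrier_vec m" using S Tv by simp
      have "T *\<^sub>v (S *\<^sub>v (T *\<^sub>v v)) = T *\<^sub>v v"
        using T S Tv TS by (metis assoc_mult_mat_vec one_mult_mat_vec)
      then have "T *\<^sub>v ?d = 0\<^sub>v n"
        using T STv v Tv by (simp add: mult_minus_distrib_mat_vec)
      then have "?d \<in> K" using STv v by (simp add: K_def)
      then have d0: "?d = 0\<^sub>v m" using K by simp
      have "S *\<^sub>v (T *\<^sub>v v) = v"
      proof (rule eq_vecI)
        fix i assume i: "i < dim_vec v"
        then have "?d $ i = 0" using d0 v by simp
        then show "(S *\<^sub>v (T *\<^sub>v v)) $ i = v $ i" using i v STv by simp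
      qed (use S v in simp)
      then show "S * T *\<^sub>v v = 1\<^sub>m m *\<^sub>v v" using S T v by (simp add: assoc_mult_mat_vec)
    qed (use S T in auto)
    then show ?thesis using S TS by blast
  qed
  moreover have "\<forall>v\<in>carrier_vec m. T *\<^sub>v v = 0\<^sub>v n" if "K = carrier_vec m"
    using that by (auto simp: K_def)
  moreover have "\<forall>v\<in>carrier_vec m. T *\<^sub>v v = 0\<^sub>v n" if "I = {0\<^sub>v n}"
    using that by (auto simp: I_def)
  ultimately show ?thesis by blast
qed

text \<open>Over the complex numbers \<open>T\<close> has an eigenvalue \<open>c\<close>. The
  difference of \<open>T\<close> and the scalar matrix \<open>c\<close> is again an intertwiner and
  kills an eigenvector, so it is not invertible and must be zero.\<close>

lemma schur_scalar:
  assumes \<rho>: "irreducible_rep G n \<rho>" and T: "T \<in> carrier_mat n n"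
    and inter: "\<And>g. g \<in> carrier G \<Longrightarrow> \<rho> g * T = T * \<rho> g"
  obtains c where "T = c \<cdot>\<^sub>m 1\<^sub>m n"
proof -
  note r = irreducible_repD[OF \<rho>]
  obtain c v where v: "v \<in> carrier_vec n" "v \<noteq> 0\<^sub>v n" "T *\<^sub>v v = c \<cdot>\<^sub>v v"
    using spectrum_non_empty[OF T r(4)] T
    by (auto simp: spectrum_def eigenvalue_def eigenvector_def)
  let ?C = "c \<cdot>\<^sub>m 1\<^sub>m n" let ?T = "T - ?C"
  have C: "?C \<in> carrier_mat n n" and T': "?T \<in> carrier_mat n n" using T by auto
  have "\<rho> g * ?T = ?T * \<rho> g" if "g \<in> carrier G" for g
  proof -
    have rc: "\<rho> g \<in> carrier_mat n n" using r(1) that .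
    have "\<rho> g * ?C = ?C * \<rho> g"
      using rc by (simp add: mult_smult_distrib[of _ n n _ n] mult_smult_assoc_mat[of _ n n _ n])
    then show ?thesis
      using T C rc inter[OF that]
      by (simp only: mult_minus_distrib_mat[OF rc T C] minus_mult_distrib_mat[OF T C rc])
  qed
  from schur_intertwiner[OF \<rho> \<rho> T' this] have "?T = 0\<^sub>m n n"
  proof
    assume "\<exists>S\<in>carrier_mat n n. ?T * S = 1\<^sub>m n \<and> S * ?T = 1\<^sub>m n"
    then obtain S where S: "S \<in> carrier_mat n n" "S * ?T = 1\<^sub>m n" by blast
    have "?C *\<^sub>v v = c \<cdot>\<^sub>v v"
      by (rule eq_vecI) (use v in auto)
    then have "?T *\<^sub>v v = 0\<^sub>v n"
      using v T C by (simp add: minus_mult_distrib_mat_vec)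
    then have "S *\<^sub>v (?T *\<^sub>v v) = 0\<^sub>v n" using S by auto
    moreover have "S *\<^sub>v (?T *\<^sub>v v) = v"
      using S T' v by (metis assoc_mult_mat_vec one_mult_mat_vec)
    ultimately show ?thesis using v by simp
  qed
  have "T = ?C"
  proof (rule eq_matI)
    fix i j assume ij: "i < dim_row ?C" "j < dim_col ?C"
    then have "?T $$ (i, j) = 0" using \<open>?T = 0\<^sub>m n n\<close> by simp
    then show "T $$ (i, j) = ?C $$ (i, j)" using ij T by simp
  qed (use T in auto)
  then show thesis by (rule that)
qed

end

section \<open>Orthogonality relations\<close>

lemma sum_rotate:
  "(\<Sum>a\<in>A. \<Sum>b\<in>B. \<Sum>c\<in>C. f a b c) = (\<Sum>b\<in>B. \<Sum>c\<in>C. \<Sum>a\<in>A. f a b c)"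
  by (subst sum.swap) (intro sum.cong refl sum.swap)

locale finite_group = group +
  assumes finite_carrier: "finite (carrier G)"
begin

lemma card_carrier_gt_0: "card (carrier G) > 0"
  using finite_carrier card_gt_0_iff by blast

lemma irreducible_rep_entry:
  assumes \<rho>: "irreducible_rep G n \<rho>" and "g \<in> carrier G" "h \<in> carrier G" "i < n" "k < n"
  shows "\<rho> (g \<otimes> h) $$ (i, k) = (\<Sum>p<n. \<rho> g $$ (i, p) * \<rho> h $$ (p, k))"
  using irreducible_repD(1)[OF \<rho>, of g] irreducible_repD(1)[OF \<rho>, of h]
    irreducible_repD(2)[OF \<rho>, of g h] assms
  by (auto simp: scalar_prod_def lessThan_atLeast0)

lemma character_eq:
  assumes "irreducible_rep G n \<rho>" "g \<in> carrier G"
  shows "character G \<rho> g = (\<Sum>i<n. \<rho> g $$ (i, i))"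
  using irreducible_repD(1)[OF assms] assms(2) by (auto simp: character_def mat_trace_def)

lemma irreducible_rep_pow:
  assumes \<rho>: "irreducible_rep G n \<rho>" and "g \<in> carrier G"
  shows "\<rho> (g [^] (k :: nat)) = \<rho> g ^\<^sub>m k"
  using irreducible_repD[OF \<rho>] assms by (induction k) auto

lemma IrrE:
  assumes "\<chi> \<in> Irr G"
  obtains n \<rho> where "irreducible_rep G n \<rho>" "\<chi> = character G \<rho>"
  using assms by (auto simp: Irr_def)

text \<open>The order of the group annihilates \<open>g\<close>, so the eigenvalues of
  \<open>\<rho> g\<close> are roots of unity of that order. That the list \<open>es\<close> does not
  depend on \<open>j\<close> makes the values on powers of \<open>g\<close> Galois conjugates of
  each other.\<close>

lemma Irr_root_sum:
  assumes "\<chi> \<in> Irr G" and g: "g \<in> carrier G"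
  obtains es where "\<And>j :: nat. \<chi> (g [^] j) = root_sum (card (carrier G)) es j"
proof -
  from assms(1) obtain n \<rho> where \<rho>: "irreducible_rep G n \<rho>" and \<chi>: "\<chi> = character G \<rho>" by (rule IrrE)
  note r = irreducible_repD[OF \<rho>]
  have "\<rho> g ^\<^sub>m card (carrier G) = 1\<^sub>m n"
    using irreducible_rep_pow[OF \<rho> g, of "card (carrier G)"] pow_order_eq_1[OF g, unfolded Coset.order_def] r(3) by simp
  then obtain es where "\<And>j. mat_trace (\<rho> g ^\<^sub>m j) = root_sum (card (carrier G)) es j"
    using mat_trace_pow_root_sum[OF r(1)[OF g] card_carrier_gt_0] by blast
  then show thesis
    using that g by (simp add: \<chi> character_def irreducible_rep_pow[OF \<rho> g])
qed

text \<open>The inverse of \<open>g\<close> is its power with exponent one less than the group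
  order, and on sums of roots of unity that exponent acts as conjugation.\<close>

lemma Irr_inv:
  assumes "\<chi> \<in> Irr G" and g: "g \<in> carrier G"
  shows "\<chi> (inv g) = cnj (\<chi> g)"
proof -
  obtain es where es: "\<And>j :: nat. \<chi> (g [^] j) = root_sum (card (carrier G)) es j"
    using Irr_root_sum[OF assms] by blast
  have "g [^] (card (carrier G) - 1) \<otimes> g = g [^] card (carrier G)"
    using g card_carrier_gt_0 by (metis Suc_diff_1 nat_pow_Suc)
  then have "inv g = g [^] (card (carrier G) - 1)"
    using g pow_order_eq_1[OF g, unfolded Coset.order_def] by (intro inv_equality) auto
  then show ?thesis
    using es[of 1] es[of "card (carrier G) - 1"] root_sum_cnj[OF card_carrier_gt_0] g by simp
qed

text \<open>\<open>T\<close> is the sum over \<open>g\<close> of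
  \<open>\<rho> g * E * \<sigma> (inv g)\<close>, where \<open>E\<close> is the elementary matrix
  with its 1 at position \<open>(k, l)\<close>. Replacing \<open>h \<otimes> g\<close> by
  \<open>g\<close> in this sum moves \<open>\<rho> h\<close> from the left to
  \<open>\<sigma> h\<close> on the right.\<close>

lemma average_intertwines:
  assumes \<rho>: "irreducible_rep G n \<rho>" and \<sigma>: "irreducible_rep G m \<sigma>"
    and k: "k < n" and l: "l < m" and h: "h \<in> carrier G"
  defines "T \<equiv> mat n m (\<lambda>(i, j). \<Sum>g\<in>carrier G. \<rho> g $$ (i, k) * \<sigma> (inv g) $$ (l, j))"
  shows "\<rho> h * T = T * \<sigma> h"
proof (rule eq_matI)
  note r = irreducible_repD(1)[OF \<rho> h] and s = irreducible_repD(1)[OF \<sigma> h]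
  fix i j assume "i < dim_row (T * \<sigma> h)" "j < dim_col (T * \<sigma> h)"
  then have ij: "i < n" "j < m" using s by (auto simp: T_def)
  have "(\<rho> h * T) $$ (i, j) = (\<Sum>p<n. \<rho> h $$ (i, p) * T $$ (p, j))"
    using r ij by (simp add: scalar_prod_def lessThan_atLeast0 T_def)
  also have "\<dots> = (\<Sum>p<n. \<Sum>g\<in>carrier G. \<rho> h $$ (i, p) * \<rho> g $$ (p, k) * \<sigma> (inv g) $$ (l, j))"
    using ij by (simp add: T_def sum_distrib_left mult.assoc)
  also have "\<dots> = (\<Sum>g\<in>carrier G. \<rho> (h \<otimes> g) $$ (i, k) * \<sigma> (inv g) $$ (l, j))"
    by (subst sum.swap)
      (auto simp: irreducible_rep_entry[OF \<rho>] h ij k sum_distrib_right intro!: sum.cong)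
  also have "\<dots> = (\<Sum>g\<in>carrier G. \<rho> g $$ (i, k) * \<sigma> (inv g \<otimes> h) $$ (l, j))"
    by (rule sum.reindex_bij_witness[where i = "\<lambda>g. inv h \<otimes> g" and j = "\<lambda>g. h \<otimes> g"])
      (use h in \<open>auto simp: m_assoc[symmetric] inv_mult_group m_assoc[of _ "inv h" h]\<close>)
  also have "\<dots> = (\<Sum>p<m. \<Sum>g\<in>carrier G. \<rho> g $$ (i, k) * \<sigma> (inv g) $$ (l, p) * \<sigma> h $$ (p, j))"
    by (subst sum.swap)
      (auto simp: irreducible_rep_entry[OF \<sigma>] h ij l sum_distrib_left mult.assoc intro!: sum.cong)
  also have "\<dots> = (\<Sum>p<m. T $$ (i, p) * \<sigma> h $$ (p, j))"
    using ij by (simp add: T_def sum_distrib_right)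
  also have "\<dots> = (T * \<sigma> h) $$ (i, j)"
    using s ij by (simp add: scalar_prod_def lessThan_atLeast0 T_def)
  finally show "(\<rho> h * T) $$ (i, j) = (T * \<sigma> h) $$ (i, j)" .
qed (use irreducible_repD(1)[OF \<rho> h] irreducible_repD(1)[OF \<sigma> h] in \<open>auto simp: T_def\<close>)

text \<open>A nonzero intertwiner is invertible by Schur's lemma, hence the two representations are
  similar and have the same traces.\<close>

lemma character_eqI_intertwiner:
  assumes \<rho>: "irreducible_rep G n \<rho>" and \<sigma>: "irreducible_rep G m \<sigma>"
    and T: "T \<in> carrier_mat n m" "T \<noteq> 0\<^sub>m n m"
    and inter: "\<And>g. g \<in> carrier G \<Longrightarrow> \<rho> g * T = T * \<sigma> g"
  shows "character G \<rho> = character G \<sigma>"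
proof -
  obtain S where S: "S \<in> carrier_mat m n" "T * S = 1\<^sub>m n" "S * T = 1\<^sub>m m"
    using schur_intertwiner[OF \<rho> \<sigma> T(1) inter] T(2) by blast
  have "mat_trace (\<rho> g) = mat_trace (\<sigma> g)" if "g \<in> carrier G" for g
  proof -
    note r = irreducible_repD(1)[OF \<rho> that] and s = irreducible_repD(1)[OF \<sigma> that]
    have "\<rho> g = \<rho> g * (T * S)" using S(2) r by simp
    also have "\<dots> = T * (\<sigma> g * S)"
      using inter[OF that] assoc_mult_mat[OF r T(1) S(1)] assoc_mult_mat[OF T(1) s S(1)] by simp
    finally have "mat_trace (\<rho> g) = mat_trace (\<sigma> g * S * T)"
      using mat_trace_mult_comm[OF T(1) mult_carrier_mat[OF s S(1)]] by simp
    also have "\<sigma> g * S * T = \<sigma> g" using assoc_mult_mat[OF s S(1) T(1)] S(3) s by simp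
    finally show ?thesis .
  qed
  then show ?thesis by (auto simp: character_def)
qed

text \<open>Each averaged matrix \<open>T k l\<close> is a scalar matrix by Schur's lemma, and its
  trace determines the scalar. The sum in question collects the entries of \<open>T i j\<close> at
  \<open>(i, j)\<close>, of which only those with \<open>i = j\<close> contribute.\<close>

lemma character_norm:
  assumes \<rho>: "irreducible_rep G n \<rho>"
  shows "(\<Sum>g\<in>carrier G. character G \<rho> g * character G \<rho> (inv g)) = of_nat (card (carrier G))"
proof -
  note r = irreducible_repD[OF \<rho>]
  define T where "T k l = mat n n (\<lambda>(i, j). \<Sum>g\<in>carrier G. \<rho> g $$ (i, k) * \<rho> (inv g) $$ (l, j))" for k l
  have T_entry: "of_nat n * T k l $$ (i, j) = (if k = l \<and> i = j then of_nat (card (carrier G)) else 0)"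
    \<comment> \<open>The factor \<open>of_nat n\<close> avoids dividing by the degree; it is
      cancelled at the end.\<close>
    if kl: "k < n" "l < n" and ij: "i < n" "j < n" for i j k l
  proof -
    have "T k l \<in> carrier_mat n n" by (simp add: T_def)
    moreover have "\<rho> h * T k l = T k l * \<rho> h" if "h \<in> carrier G" for h
      unfolding T_def using average_intertwines[OF \<rho> \<rho> kl that] .
    ultimately obtain c where c: "T k l = c \<cdot>\<^sub>m 1\<^sub>m n" using schur_scalar[OF \<rho>] by blast
    have "of_nat n * c = (\<Sum>i<n. T k l $$ (i, i))" by (simp add: c)
    \<comment> \<open>In the trace the two factors multiply to
      \<open>\<rho> (inv g \<otimes> g)\<close>, the identity, for every \<open>g\<close>.\<close>
    also have "\<dots> = (\<Sum>i<n. \<Sum>g\<in>carrier G. \<rho> (inv g) $$ (l, i) * \<rho> g $$ (i, k))"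
      by (simp add: T_def mult.commute)
    also have "\<dots> = (\<Sum>g\<in>carrier G. \<rho> (inv g \<otimes> g) $$ (l, k))"
      by (subst sum.swap) (intro sum.cong refl, simp only: irreducible_rep_entry[OF \<rho>] kl inv_closed)
    also have "\<dots> = (if k = l then of_nat (card (carrier G)) else 0)"
      using kl r(3) by simp
    finally have nc: "of_nat n * c = (if k = l then of_nat (card (carrier G)) else 0)" .
    have "of_nat n * T k l $$ (i, j) = (if i = j then of_nat n * c else 0)"
      using ij by (simp add: c)
    then show ?thesis by (simp add: nc)
  qed
  have "of_nat n * (\<Sum>g\<in>carrier G. character G \<rho> g * character G \<rho> (inv g)) =
      of_nat n * (\<Sum>g\<in>carrier G. \<Sum>i<n. \<Sum>j<n. \<rho> g $$ (i, i) * \<rho> (inv g) $$ (j, j))"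
    by (simp add: character_eq[OF \<rho>] sum_product)
  also have "\<dots> = of_nat n * (\<Sum>i<n. \<Sum>j<n. T i j $$ (i, j))"
    by (subst sum_rotate) (simp add: T_def)
  also have "\<dots> = (\<Sum>i<n. \<Sum>j<n. if i = j then of_nat (card (carrier G)) else 0)"
    by (simp add: sum_distrib_left T_entry)
  also have "\<dots> = of_nat n * of_nat (card (carrier G))" by simp
  finally show ?thesis using r(4) by simp
qed

text \<open>Here the averaged matrices are all zero, since a nonzero one would be an intertwiner and
  force equal characters.\<close>

lemma character_orthogonal:
  assumes \<rho>: "irreducible_rep G n \<rho>" and \<sigma>: "irreducible_rep G m \<sigma>"
    and neq: "character G \<rho> \<noteq> character G \<sigma>"
  shows "(\<Sum>g\<in>carrier G. character G \<rho> g * character G \<sigma> (inv g)) = 0"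
proof -
  define T where "T k l = mat n m (\<lambda>(i, j). \<Sum>g\<in>carrier G. \<rho> g $$ (i, k) * \<sigma> (inv g) $$ (l, j))" for k l
  have T: "T k l = 0\<^sub>m n m" if "k < n" "l < m" for k l
  proof -
    have "T k l \<in> carrier_mat n m" by (simp add: T_def)
    moreover have "\<rho> h * T k l = T k l * \<sigma> h" if "h \<in> carrier G" for h
      unfolding T_def using average_intertwines[OF \<rho> \<sigma> \<open>k < n\<close> \<open>l < m\<close> that] .
    ultimately show ?thesis using character_eqI_intertwiner[OF \<rho> \<sigma>] neq by blast
  qed
  have "(\<Sum>g\<in>carrier G. character G \<rho> g * character G \<sigma> (inv g)) =
      (\<Sum>g\<in>carrier G. \<Sum>i<n. \<Sum>j<m. \<rho> g $$ (i, i) * \<sigma> (inv g) $$ (j, j))"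
    by (simp add: character_eq[OF \<rho>] character_eq[OF \<sigma>] sum_product)
  also have "\<dots> = (\<Sum>i<n. \<Sum>j<m. T i j $$ (i, j))"
    by (subst sum_rotate) (simp add: T_def)
  also have "\<dots> = 0" by (simp add: T)
  finally show ?thesis .
qed

lemma Irr_orthogonality:
  assumes "\<chi> \<in> Irr G" "\<psi> \<in> Irr G"
  shows "(\<Sum>g\<in>carrier G. \<chi> g * cnj (\<psi> g)) = (if \<chi> = \<psi> then of_nat (card (carrier G)) else 0)"
proof -
  from assms obtain n \<rho> m \<sigma> where \<rho>: "irreducible_rep G n \<rho>" "\<chi> = character G \<rho>"
    and \<sigma>: "irreducible_rep G m \<sigma>" "\<psi> = character G \<sigma>" by (elim IrrE)
  have "(\<Sum>g\<in>carrier G. \<chi> g * cnj (\<psi> g)) = (\<Sum>g\<in>carrier G. \<chi> g * \<psi> (inv g))"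
    using Irr_inv[OF assms(2)] by simp
  then show ?thesis
    using character_norm[OF \<rho>(1)] character_orthogonal[OF \<rho>(1) \<sigma>(1)] \<rho>(2) \<sigma>(2) by auto
qed

section \<open>Bessel's inequality and the finiteness of the set of irreducible characters\<close>

text \<open>Bessel's inequality for the indicator function of \<open>D\<close>.\<close>
lemma Irr_bessel:
  assumes F: "finite F" "F \<subseteq> Irr G" and D: "D \<subseteq> carrier G"
  shows "(\<Sum>\<chi>\<in>F. (norm (\<Sum>g\<in>D. \<chi> g))\<^sup>2) \<le> real (card (carrier G)) * real (card D)"
proof -
  define N where "N = card (carrier G)"
  have N: "N > 0" using card_carrier_gt_0 by (simp add: N_def)
  define s where "s \<chi> = (\<Sum>g\<in>D. \<chi> g)" for \<chi> :: "'a \<Rightarrow> complex"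
  define d where "d g = (if g \<in> D then 1 else 0 :: complex)" for g
  \<comment> \<open>\<open>p\<close> is \<open>N\<close> times the orthogonal projection of the
    indicator function \<open>d\<close> onto the span of \<open>F\<close>.\<close>
  define p where "p g = (\<Sum>\<chi>\<in>F. cnj (s \<chi>) * \<chi> g)" for g
  have finD: "finite D" using D finite_carrier finite_subset by blast
  have dp: "(\<Sum>g\<in>carrier G. d g * cnj (p g)) = (\<Sum>\<chi>\<in>F. s \<chi> * cnj (s \<chi>))"
  proof -
    have ip: "(\<Sum>g\<in>carrier G. d g * cnj (\<chi> g)) = cnj (s \<chi>)" for \<chi>
    proof -
      have "(\<Sum>g\<in>carrier G. d g * cnj (\<chi> g)) = (\<Sum>g\<in>D. cnj (\<chi> g))"
        using D finite_carrier by (simp add: d_def if_distrib[of "\<lambda>x. x * _"] sum.If_cases Int_absorb1 cong: if_cong)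
      then show ?thesis by (simp add: s_def)
    qed
    have "(\<Sum>g\<in>carrier G. d g * cnj (p g)) = (\<Sum>\<chi>\<in>F. s \<chi> * (\<Sum>g\<in>carrier G. d g * cnj (\<chi> g)))"
      unfolding p_def sum_distrib_left cnj_sum
      by (subst sum.swap) (simp add: mult_ac)
    also have "\<dots> = (\<Sum>\<chi>\<in>F. s \<chi> * cnj (s \<chi>))" by (simp add: ip)
    finally show ?thesis .
  qed
  have pp: "(\<Sum>g\<in>carrier G. p g * cnj (p g)) = of_nat N * (\<Sum>\<chi>\<in>F. s \<chi> * cnj (s \<chi>))"
  proof -
    have "(\<Sum>g\<in>carrier G. p g * cnj (p g)) =
        (\<Sum>g\<in>carrier G. \<Sum>\<chi>\<in>F. \<Sum>\<psi>\<in>F. cnj (s \<chi>) * s \<psi> * (\<chi> g * cnj (\<psi> g)))"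
      by (simp add: p_def sum_product mult_ac)
    also have "\<dots> = (\<Sum>\<chi>\<in>F. \<Sum>\<psi>\<in>F. \<Sum>g\<in>carrier G. cnj (s \<chi>) * s \<psi> * (\<chi> g * cnj (\<psi> g)))"
      by (rule sum_rotate)
    also have "\<dots> = (\<Sum>\<chi>\<in>F. \<Sum>\<psi>\<in>F. if \<chi> = \<psi> then cnj (s \<chi>) * s \<psi> * of_nat N else 0)"
      using F(2) by (intro sum.cong refl)
        (auto simp: sum_distrib_left[symmetric] Irr_orthogonality N_def subset_iff)
    also have "\<dots> = of_nat N * (\<Sum>\<chi>\<in>F. s \<chi> * cnj (s \<chi>))"
      using F(1) by (simp add: sum_distrib_left mult_ac)
    finally show ?thesis .
  qed
  define Q where "Q = (\<Sum>\<chi>\<in>F. (norm (s \<chi>))\<^sup>2)"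
  have Q: "(\<Sum>\<chi>\<in>F. s \<chi> * cnj (s \<chi>)) = of_real Q"
    by (simp only: Q_def of_real_sum complex_norm_square)
  \<comment> \<open>The squared distance from \<open>N\<close> times \<open>d\<close> to
    \<open>p\<close> expands to \<open>N * (N * card D - Q)\<close>; that it is nonnegative is the
    inequality.\<close>
  have "complex_of_real (\<Sum>g\<in>carrier G. (norm (of_nat N * d g - p g))\<^sup>2) =
      (\<Sum>g\<in>carrier G. (of_nat N * d g - p g) * cnj (of_nat N * d g - p g))"
    by (simp only: of_real_sum complex_norm_square)
  also have "\<dots> = (\<Sum>g\<in>carrier G. of_nat N * of_nat N * (d g * cnj (d g))) -
      (\<Sum>g\<in>carrier G. of_nat N * (d g * cnj (p g))) - (\<Sum>g\<in>carrier G. of_nat N * cnj (d g * cnj (p g))) +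
      (\<Sum>g\<in>carrier G. p g * cnj (p g))"
    by (simp add: algebra_simps sum.distrib sum_subtractf)
  also have "\<dots> = of_nat N * of_nat N * (\<Sum>g\<in>carrier G. d g * cnj (d g)) -
      of_nat N * (\<Sum>g\<in>carrier G. d g * cnj (p g)) - of_nat N * cnj (\<Sum>g\<in>carrier G. d g * cnj (p g)) +
      (\<Sum>g\<in>carrier G. p g * cnj (p g))"
    by (simp only: sum_distrib_left[symmetric] cnj_sum)
  also have "(\<Sum>g\<in>carrier G. d g * cnj (d g)) = of_nat (card D)"
    using D finite_carrier by (simp add: d_def if_distrib[of "\<lambda>x. x * _"] sum.If_cases Int_absorb1 cong: if_cong)
  also have "of_nat N * of_nat N * of_nat (card D) - of_nat N * (\<Sum>g\<in>carrier G. d g * cnj (p g)) -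
      of_nat N * cnj (\<Sum>g\<in>carrier G. d g * cnj (p g)) + (\<Sum>g\<in>carrier G. p g * cnj (p g)) =
      complex_of_real (real N * (real N * card D - Q))"
    by (simp add: dp pp Q algebra_simps)
  finally have "(\<Sum>g\<in>carrier G. (norm (of_nat N * d g - p g))\<^sup>2) = real N * (real N * card D - Q)"
    by (simp only: of_real_eq_iff)
  moreover have "(\<Sum>g\<in>carrier G. (norm (of_nat N * d g - p g))\<^sup>2) \<ge> 0" by (intro sum_nonneg) simp
  ultimately have "Q \<le> real N * card D" using N by (simp add: zero_le_mult_iff)
  then show ?thesis by (simp add: Q_def s_def N_def)
qed

lemma Irr_one:
  assumes "\<chi> \<in> Irr G"
  obtains n where "n > 0" "\<chi> \<one> = of_nat n"
  using assms
proof (rule IrrE)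
  fix n \<rho> assume \<rho>: "irreducible_rep G n \<rho>" "\<chi> = character G \<rho>"
  then show thesis
    using that[of n] character_eq[OF \<rho>(1), of \<one>] irreducible_repD(3,4)[OF \<rho>(1)] by simp
qed

text \<open>In Bessel's inequality for \<open>D = {\<one>}\<close> each character contributes the
  square of its degree, at least 1, and the bound is the group order.\<close>

lemma finite_Irr: "finite (Irr G)"
proof (rule ccontr)
  assume "infinite (Irr G)"
  then obtain F where F: "F \<subseteq> Irr G" "finite F" "card F = Suc (card (carrier G))"
    by (meson infinite_arbitrarily_large)
  have "norm (\<chi> \<one>) \<ge> 1" if \<chi>: "\<chi> \<in> F" for \<chi>
    using F(1) \<chi> by (auto elim!: Irr_one[of \<chi>])
  then have "(\<Sum>\<chi>\<in>F. 1) \<le> (\<Sum>\<chi>\<in>F. (norm (\<Sum>g\<in>{\<one>}. \<chi> g))\<^sup>2)"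
    by (intro sum_mono) simp
  also have "\<dots> \<le> real (card (carrier G))" using Irr_bessel[OF F(2,1), of "{\<one>}"] by simp
  finally show False using F(3) by simp
qed

lemma Irr_conj:
  assumes "\<chi> \<in> Irr G" "g \<in> carrier G" "h \<in> carrier G"
  shows "\<chi> (h \<otimes> g \<otimes> inv h) = \<chi> g"
proof -
  from assms(1) obtain n \<rho> where \<rho>: "irreducible_rep G n \<rho>" and \<chi>: "\<chi> = character G \<rho>" by (rule IrrE)
  note r = irreducible_repD[OF \<rho>]
  have "mat_trace (\<rho> (h \<otimes> g \<otimes> inv h)) = mat_trace (\<rho> (inv h) * \<rho> (h \<otimes> g))"
    using assms mat_trace_mult_comm[OF r(1) r(1), of "h \<otimes> g" "inv h"] r(2) by simp
  also have "\<dots> = mat_trace (\<rho> (inv h \<otimes> (h \<otimes> g)))" using assms r(2) by simp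
  also have "inv h \<otimes> (h \<otimes> g) = g" using assms by (simp add: m_assoc[symmetric])
  finally show ?thesis using assms by (simp add: \<chi> character_def)
qed

end

section \<open>Zeros and linear characters\<close>

context finite_group
begin

section \<open>Burnside's theorem on zeros of nonlinear characters\<close>

lemma pow_mod_card:
  assumes "g \<in> carrier G" shows "g [^] (a mod card (carrier G)) = g [^] (a :: nat)"
proof -
  let ?N = "card (carrier G)"
  have "g [^] a = g [^] (?N * (a div ?N) + a mod ?N)" by simp
  also have "\<dots> = (g [^] ?N) [^] (a div ?N) \<otimes> g [^] (a mod ?N)"
    using assms by (simp only: nat_pow_mult[symmetric] nat_pow_pow)
  also have "g [^] ?N = \<one>" using pow_order_eq_1[OF assms] by (simp add: Coset.order_def)
  finally show ?thesis using assms by simp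
qed

text \<open>If \<open>i\<close> inverts \<open>j\<close> modulo the group order, then raising to the
  \<open>i\<close>th power undoes raising to the \<open>j\<close>th.\<close>

lemma bij_betw_pow_coprime:
  assumes "coprime j (card (carrier G))"
  shows "bij_betw (\<lambda>g. g [^] j) (carrier G) (carrier G)"
proof -
  obtain i where "[j * i = 1] (mod card (carrier G))"
    using cong_solve_coprime_nat[OF assms] by auto
  then have "(g [^] j) [^] i = g" if "g \<in> carrier G" for g
    using that pow_mod_card[of g "j * i"] pow_mod_card[of g 1] by (simp add: nat_pow_pow cong_def)
  then have "inj_on (\<lambda>g. g [^] j) (carrier G)"
    by (rule inj_on_inverseI[where g = "\<lambda>g. g [^] i"])
  then show ?thesis
    by (simp add: bij_betw_def endo_inj_surj finite_carrier image_subset_iff)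
qed

text \<open>Suppose there is no zero. By orthogonality \<open>f\<close>, the squared modulus of
  \<open>\<chi>\<close>, has mean 1 over the group. Products of Galois conjugates of values have
  norm at least 1, so the sum of \<open>ln (f g)\<close> is nonnegative. This contradicts the
  inequality of arithmetic and geometric means, which is strict because
  \<open>f \<one> > 1\<close>.\<close>

theorem burnside_zero:
  assumes \<chi>: "\<chi> \<in> Irr G" and nonlinear: "\<chi> \<one> \<noteq> 1"
  shows "\<exists>g\<in>carrier G. \<chi> g = 0"
proof (rule ccontr)
  assume "\<not> ?thesis"
  then have nz: "\<chi> g \<noteq> 0" if "g \<in> carrier G" for g using that by blast
  define N where "N = card (carrier G)"
  define f where "f g = (norm (\<chi> g))\<^sup>2" for g
  have f_pos: "f g > 0" if "g \<in> carrier G" for g using nz[OF that] by (simp add: f_def)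
  obtain n where n: "n > 0" "\<chi> \<one> = of_nat n" using Irr_one[OF \<chi>] .
  with nonlinear have "n > 1" by (cases "n = 1") auto
  then have f1: "f \<one> > 1" using n by (simp add: f_def)
  have norm: "(\<Sum>g\<in>carrier G. f g) = real N"
  proof -
    have "complex_of_real (\<Sum>g\<in>carrier G. f g) = complex_of_real (real N)"
      using Irr_orthogonality[OF \<chi> \<chi>] by (simp only: f_def of_real_sum complex_norm_square) (simp add: N_def)
    then show ?thesis by (simp only: of_real_eq_iff)
  qed
  have "N > 1"
  proof (rule ccontr)
    assume "\<not> N > 1"
    then have "card (carrier G) = 1" using card_carrier_gt_0 by (simp add: N_def)
    then have "carrier G = {\<one>}" using one_closed by (metis card_1_singletonE singletonD)
    then show False using norm f1 \<open>\<not> N > 1\<close> by simp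
  qed
  \<comment> \<open>Power maps with exponent coprime to \<open>N\<close> permute the group, so the
    sum of logarithms may be averaged over all conjugates.\<close>
  have "real (totient N) * (\<Sum>g\<in>carrier G. ln (f g)) = (\<Sum>j\<in>totatives N. \<Sum>g\<in>carrier G. ln (f (g [^] j)))"
  proof -
    have "(\<Sum>g\<in>carrier G. ln (f (g [^] j))) = (\<Sum>g\<in>carrier G. ln (f g))" if "j \<in> totatives N" for j
      using that by (intro sum.reindex_bij_betw bij_betw_pow_coprime) (auto simp: totatives_def N_def)
    then show ?thesis by (simp add: totient_def)
  qed
  also have "\<dots> = (\<Sum>g\<in>carrier G. \<Sum>j\<in>totatives N. ln (f (g [^] j)))" by (rule sum.swap)
  also have "\<dots> \<ge> 0"
  proof (rule sum_nonneg)
    fix g assume g: "g \<in> carrier G"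
    \<comment> \<open>The values of \<open>\<chi>\<close> at the powers of \<open>g\<close> with
      exponents in \<open>totatives N\<close> are thus all conjugates of one cyclotomic
      integer.\<close>
    obtain es where es: "\<And>j :: nat. \<chi> (g [^] j) = root_sum N es j"
      using Irr_root_sum[OF \<chi> g] unfolding N_def by blast
    have "norm (\<Prod>j\<in>totatives N. root_sum N es j) \<ge> 1"
      using nz g by (intro norm_prod_root_sum_ge_1 \<open>N > 1\<close>) (simp add: es[symmetric])
    then have "(norm (\<Prod>j\<in>totatives N. \<chi> (g [^] j)))\<^sup>2 \<ge> 1" by (simp add: es)
    then have "0 \<le> ln ((norm (\<Prod>j\<in>totatives N. \<chi> (g [^] j)))\<^sup>2)" by (rule ln_ge_zero)
    also have "\<dots> = ln (\<Prod>j\<in>totatives N. f (g [^] j))"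
      by (simp only: f_def prod_norm[symmetric] prod_power_distrib)
    also have "\<dots> = (\<Sum>j\<in>totatives N. ln (f (g [^] j)))"
    proof (rule ln_prod)
      fix j :: nat
      have "f (g [^] j) > 0" using f_pos g by simp
      then show "f (g [^] j) \<noteq> 0" by simp
    qed simp
    finally show "0 \<le> (\<Sum>j\<in>totatives N. ln (f (g [^] j)))" .
  qed
  finally have "0 \<le> (\<Sum>g\<in>carrier G. ln (f g))"
    using \<open>N > 1\<close> by (simp add: zero_le_mult_iff)
  \<comment> \<open>The logarithm of \<open>f g\<close> is at most \<open>f g - 1\<close>, with
    strict inequality at \<open>\<one>\<close>, while the right-hand sides sum to 0.\<close>
  also have "\<dots> < (\<Sum>g\<in>carrier G. f g - 1)"
  proof (rule sum_strict_mono_ex1[OF finite_carrier])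
    show "\<forall>g\<in>carrier G. ln (f g) \<le> f g - 1" using f_pos by (simp add: ln_le_minus_one)
    have "ln (f \<one>) < f \<one> - 1"
      using f1 ln_le_minus_one[of "f \<one>"] ln_eq_minus_one[of "f \<one>"] by force
    then show "\<exists>g\<in>carrier G. ln (f g) < f g - 1" by blast
  qed
  also have "\<dots> = 0" by (simp add: sum_subtractf norm N_def)
  finally show False by simp
qed

section \<open>Linear characters and their common kernel\<close>

definition Lin :: "('a \<Rightarrow> complex) set" where
  "Lin = {\<eta> \<in> Irr G. \<eta> \<one> = 1}"

lemma LinE:
  assumes "\<eta> \<in> Lin"
  obtains \<rho> where "irreducible_rep G 1 \<rho>" "\<eta> = character G \<rho>"
    "\<And>g. g \<in> carrier G \<Longrightarrow> \<eta> g = \<rho> g $$ (0, 0)"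
proof -
  from assms have "\<eta> \<in> Irr G" and one: "\<eta> \<one> = 1" by (auto simp: Lin_def)
  then obtain n \<rho> where \<rho>: "irreducible_rep G n \<rho>" "\<eta> = character G \<rho>" by (elim IrrE)
  then have "n = 1"
    using one character_eq[OF \<rho>(1), of \<one>] irreducible_repD(3)[OF \<rho>(1)] by simp
  then show thesis using that \<rho> character_eq[OF \<rho>(1)] by simp
qed

lemma Lin_mult:
  assumes "\<eta> \<in> Lin" "g \<in> carrier G" "h \<in> carrier G"
  shows "\<eta> (g \<otimes> h) = \<eta> g * \<eta> h"
  using assms(1)
proof (rule LinE)
  fix \<rho> assume \<rho>: "irreducible_rep G 1 \<rho>" and eq: "\<And>g. g \<in> carrier G \<Longrightarrow> \<eta> g = \<rho> g $$ (0, 0)"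
  show ?thesis
    using irreducible_rep_entry[OF \<rho> assms(2,3), of 0 0] assms eq by simp
qed

lemma Lin_mult_cnj:
  assumes "\<eta> \<in> Lin" "g \<in> carrier G" shows "\<eta> g * cnj (\<eta> g) = 1"
proof -
  have "\<eta> g * \<eta> (inv g) = \<eta> \<one>" using Lin_mult[OF assms, of "inv g"] assms by simp
  then show ?thesis using assms Irr_inv[of \<eta> g] by (simp add: Lin_def)
qed

lemma Lin_nonzero:
  assumes "\<eta> \<in> Lin" "g \<in> carrier G" shows "\<eta> g \<noteq> 0"
  using Lin_mult_cnj[OF assms] by auto

text \<open>The product is afforded by \<open>\<eta> g \<cdot>\<^sub>m \<rho> g\<close>. As
  \<open>\<eta>\<close> has no zeros, these matrices have the same invariant subspaces as the
  \<open>\<rho> g\<close>.\<close>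

lemma Lin_times_Irr:
  assumes \<eta>: "\<eta> \<in> Lin" and \<chi>: "\<chi> \<in> Irr G"
  shows "(\<lambda>g\<in>carrier G. \<eta> g * \<chi> g) \<in> Irr G"
proof -
  from \<chi> obtain n \<rho> where \<rho>: "irreducible_rep G n \<rho>" and \<chi>: "\<chi> = character G \<rho>" by (rule IrrE)
  note r = irreducible_repD[OF \<rho>]
  define \<sigma> where "\<sigma> g = \<eta> g \<cdot>\<^sub>m \<rho> g" for g
  have "irreducible_rep G n \<sigma>"
    unfolding irreducible_rep_iff
  proof (intro conjI allI impI ballI)
    fix g h assume gh: "g \<in> carrier G" "h \<in> carrier G"
    show "\<sigma> (g \<otimes> h) = \<sigma> g * \<sigma> h"
      unfolding \<sigma>_def Lin_mult[OF \<eta> gh] r(2)[OF gh]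
      by (rule eq_matI) (use r(1)[OF gh(1)] r(1)[OF gh(2)] in auto)
  next
    fix W :: "complex vec set"
    assume W: "W \<subseteq> carrier_vec n" "0\<^sub>v n \<in> W" "\<forall>v\<in>W. \<forall>w\<in>W. v + w \<in> W" "\<forall>c. \<forall>v\<in>W. c \<cdot>\<^sub>v v \<in> W"
      and inv: "\<forall>g\<in>carrier G. \<forall>w\<in>W. \<sigma> g *\<^sub>v w \<in> W"
    have "\<forall>g\<in>carrier G. \<forall>w\<in>W. \<rho> g *\<^sub>v w \<in> W"
    proof (intro ballI)
      fix g w assume g: "g \<in> carrier G" and w: "w \<in> W"
      have "\<rho> g *\<^sub>v w = inverse (\<eta> g) \<cdot>\<^sub>v (\<sigma> g *\<^sub>v w)"
      proof (rule eq_vecI)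
        fix i assume "i < dim_vec (inverse (\<eta> g) \<cdot>\<^sub>v (\<sigma> g *\<^sub>v w))"
        then have i: "i < n" using r(1)[OF g] by (simp add: \<sigma>_def)
        have "w \<in> carrier_vec n" using W w by blast
        then show "(\<rho> g *\<^sub>v w) $ i = (inverse (\<eta> g) \<cdot>\<^sub>v (\<sigma> g *\<^sub>v w)) $ i"
          using i r(1)[OF g] Lin_nonzero[OF \<eta> g]
          by (simp add: \<sigma>_def scalar_prod_def sum_distrib_left mult.assoc[symmetric])
      qed (simp add: \<sigma>_def)
      then show "\<rho> g *\<^sub>v w \<in> W" using W(4) inv g w by simp
    qed
    with W show "W = {0\<^sub>v n} \<or> W = carrier_vec n" by (intro irreducible_rep_subspace[OF \<rho>])
  qed (use r \<eta> in \<open>auto simp: \<sigma>_def Lin_def intro!: smult_carrier_mat\<close>)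
  moreover have "(\<lambda>g\<in>carrier G. \<eta> g * \<chi> g) = character G \<sigma>"
    unfolding character_def
  proof (rule restrict_ext)
    fix g assume g: "g \<in> carrier G"
    then show "\<eta> g * \<chi> g = mat_trace (\<sigma> g)"
      using r(1)[OF g] by (auto simp: character_def \<chi> \<sigma>_def mat_trace_def sum_distrib_left)
  qed
  ultimately show ?thesis unfolding Irr_def by blast
qed

text \<open>This is the subgroup \<open>D\<close> of the overview. It contains all commutators,
  hence its link with conjugacy classes.\<close>

definition Lin_kernel :: "'a set" where
  "Lin_kernel = {g \<in> carrier G. \<forall>\<eta>\<in>Lin. \<eta> g = 1}"

lemma Lin_kernel_props: "\<one> \<in> Lin_kernel" "finite Lin_kernel" "card Lin_kernel > 0"
  using finite_carrier by (auto simp: Lin_kernel_def Lin_def card_gt_0_iff)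

text \<open>Bessel's inequality is applied to the linear characters and the indicator function of
  their common kernel: each of them is 1 there, so each contributes the square of the order of the
  kernel.\<close>

lemma card_Lin_le: "card Lin * card Lin_kernel \<le> card (carrier G)"
proof -
  let ?d = "card Lin_kernel"
  have "finite Lin" using finite_Irr by (simp add: Lin_def)
  have "(\<Sum>\<eta>\<in>Lin. (norm (\<Sum>g\<in>Lin_kernel. \<eta> g))\<^sup>2) = (\<Sum>\<eta>\<in>Lin. (real ?d)\<^sup>2)"
  proof (intro sum.cong refl)
    fix \<eta> assume "\<eta> \<in> Lin"
    then have "(\<Sum>g\<in>Lin_kernel. \<eta> g) = (\<Sum>g\<in>Lin_kernel. 1)"
      by (intro sum.cong refl) (simp add: Lin_kernel_def)
    then show "(norm (\<Sum>g\<in>Lin_kernel. \<eta> g))\<^sup>2 = (real ?d)\<^sup>2" by simp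
  qed
  then have "real (card Lin) * (real ?d)\<^sup>2 \<le> real (card (carrier G)) * real ?d"
    using Irr_bessel[OF \<open>finite Lin\<close>, of Lin_kernel] by (simp add: Lin_def Lin_kernel_def)
  then have "real (card Lin) * real ?d \<le> real (card (carrier G))"
    using Lin_kernel_props(3) by (simp add: power2_eq_square mult.assoc[symmetric])
  then show ?thesis by (simp flip: of_nat_mult)
qed

section \<open>Counting zeros by conjugacy classes\<close>

lemma conjugacy_classes_eq:
  "conjugacy_classes G = (\<lambda>g. (\<lambda>h. h \<otimes> g \<otimes> inv h) ` carrier G) ` carrier G"
  by (auto simp: conjugacy_classes_def orbits_def orbit_def image_def)

lemma finite_conjugacy_classes: "finite (conjugacy_classes G)"
  using finite_carrier by (simp add: conjugacy_classes_eq)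

text \<open>Right multiplication by \<open>inv g\<close> sends the conjugates of \<open>g\<close>
  injectively to commutators, on which every linear character is 1.\<close>

lemma card_conjugacy_class_le:
  assumes "C \<in> conjugacy_classes G"
  shows "card C \<le> card Lin_kernel"
proof -
  from assms obtain g where g: "g \<in> carrier G" and C: "C = (\<lambda>h. h \<otimes> g \<otimes> inv h) ` carrier G"
    by (auto simp: conjugacy_classes_eq)
  show ?thesis
  proof (rule card_inj_on_le)
    show "inj_on (\<lambda>x. x \<otimes> inv g) C" using g by (auto simp: C intro!: inj_onI)
    show "(\<lambda>x. x \<otimes> inv g) ` C \<subseteq> Lin_kernel"
    proof
      fix y assume "y \<in> (\<lambda>x. x \<otimes> inv g) ` C"
      then obtain h where h: "h \<in> carrier G" and y: "y = h \<otimes> g \<otimes> inv h \<otimes> inv g" by (auto simp: C)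
      have "\<eta> y = 1" if \<eta>: "\<eta> \<in> Lin" for \<eta>
      proof -
        have "\<eta> y = \<eta> (h \<otimes> g \<otimes> inv h) * \<eta> (inv g)" using Lin_mult[OF \<eta>] g h y by simp
        also have "\<dots> = \<eta> g * cnj (\<eta> g)"
          using \<eta> g h by (simp add: Irr_conj Irr_inv Lin_def)
        finally show ?thesis using Lin_mult_cnj[OF \<eta> g] by simp
      qed
      then show "y \<in> Lin_kernel" using g h y by (simp add: Lin_kernel_def)
    qed
  qed (rule Lin_kernel_props)
qed

definition zero_classes :: "('a \<Rightarrow> complex) \<Rightarrow> 'a set set" where
  "zero_classes \<chi> = {C \<in> conjugacy_classes G. \<forall>g\<in>C. \<chi> g = 0}"

lemma nz_eq: "nz G = (\<Sum>\<chi>\<in>Irr G. card (zero_classes \<chi>))"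
proof -
  have "{(\<chi>, C). \<chi> \<in> Irr G \<and> C \<in> conjugacy_classes G \<and> (\<forall>g\<in>C. \<chi> g = 0)} = Sigma (Irr G) zero_classes"
    by (auto simp: zero_classes_def)
  then show ?thesis
    using finite_Irr finite_conjugacy_classes by (simp add: nz_def zero_classes_def)
qed

text \<open>Characters are constant on conjugacy classes, so the zeros are covered by whole classes,
  each no larger than the common kernel.\<close>

lemma card_zeros_le:
  assumes "\<chi> \<in> Irr G"
  shows "card {g \<in> carrier G. \<chi> g = 0} \<le> card (zero_classes \<chi>) * card Lin_kernel"
proof -
  have fin: "finite (zero_classes \<chi>)" using finite_conjugacy_classes by (simp add: zero_classes_def)
  have "{g \<in> carrier G. \<chi> g = 0} \<subseteq> \<Union> (zero_classes \<chi>)"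
  proof
    fix g assume "g \<in> {g \<in> carrier G. \<chi> g = 0}"
    then have g: "g \<in> carrier G" "\<chi> g = 0" by auto
    let ?C = "(\<lambda>h. h \<otimes> g \<otimes> inv h) ` carrier G"
    have "?C \<in> zero_classes \<chi>"
      using g Irr_conj[OF assms g(1)] by (auto simp: zero_classes_def conjugacy_classes_eq)
    moreover have "g \<in> ?C" using g by (auto intro!: image_eqI[of _ _ \<one>])
    ultimately show "g \<in> \<Union> (zero_classes \<chi>)" by blast
  qed
  moreover have "finite (\<Union> (zero_classes \<chi>))"
    using fin finite_carrier by (auto simp: zero_classes_def conjugacy_classes_eq)
  ultimately have "card {g \<in> carrier G. \<chi> g = 0} \<le> card (\<Union> (zero_classes \<chi>))"
    by (rule card_mono[rotated])
  also have "\<dots> \<le> (\<Sum>C\<in>zero_classes \<chi>. card C)" by (rule card_Union_le_sum_card)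
  also have "\<dots> \<le> (\<Sum>C\<in>zero_classes \<chi>. card Lin_kernel)"
    by (intro sum_mono card_conjugacy_class_le) (simp add: zero_classes_def)
  finally show ?thesis by simp
qed

lemma card_zero_classes_ge_1:
  assumes "\<chi> \<in> Irr G" "\<chi> \<one> \<noteq> 1"
  shows "card (zero_classes \<chi>) \<ge> 1"
proof -
  have "{g \<in> carrier G. \<chi> g = 0} \<noteq> {}" using burnside_zero[OF assms] by blast
  then have "card {g \<in> carrier G. \<chi> g = 0} > 0" using finite_carrier by (simp add: card_gt_0_iff)
  then show ?thesis using card_zeros_le[OF assms(1)] by (cases "card (zero_classes \<chi>)") auto
qed

lemma card_zero_classes_ge_Lin:
  assumes \<chi>: "\<chi> \<in> Irr G" and \<eta>: "\<eta> \<in> Lin" and \<mu>: "\<mu> \<in> Lin" and neq: "\<eta> \<noteq> \<mu>"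
    and eq: "\<And>g. g \<in> carrier G \<Longrightarrow> \<eta> g * \<chi> g = \<mu> g * \<chi> g"
  shows "card Lin \<le> 2 * card (zero_classes \<chi>)"
proof -
  define K where "K = {g \<in> carrier G. \<eta> g = \<mu> g}"
  \<comment> \<open>All characters are \<open>undefined\<close> off the carrier, so two different
    ones differ at some group element.\<close>
  have ext: "\<eta> \<in> extensional (carrier G)" "\<mu> \<in> extensional (carrier G)"
    using \<eta> \<mu> by (auto simp: Lin_def Irr_def character_def)
  obtain x where x: "x \<in> carrier G" "\<eta> x \<noteq> \<mu> x"
    using neq extensionalityI[OF ext] by blast
  have Z: "carrier G - K \<subseteq> {g \<in> carrier G. \<chi> g = 0}" using eq by (auto simp: K_def)
  \<comment> \<open>The translate of \<open>K\<close> by \<open>x\<close> is disjoint from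
    \<open>K\<close>, so \<open>K\<close> fills at most half of the group.\<close>
  have "card K \<le> card (carrier G - K)"
  proof (rule card_inj_on_le)
    show "inj_on (\<lambda>k. x \<otimes> k) K" using x by (auto simp: K_def intro!: inj_onI)
    show "(\<lambda>k. x \<otimes> k) ` K \<subseteq> carrier G - K"
      using x Lin_mult[OF \<eta> x(1)] Lin_mult[OF \<mu> x(1)] Lin_nonzero[OF \<mu>] by (auto simp: K_def)
  qed (use finite_carrier in simp)
  moreover have "card (carrier G) = card K + card (carrier G - K)"
    using card_Diff_subset[of K "carrier G"] card_mono[of "carrier G" K] finite_carrier
    by (auto simp: K_def)
  ultimately have "card (carrier G) \<le> 2 * card (carrier G - K)" by simp
  also have "\<dots> \<le> 2 * card {g \<in> carrier G. \<chi> g = 0}"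
    using card_mono[OF _ Z] finite_carrier by simp
  also have "\<dots> \<le> 2 * (card (zero_classes \<chi>) * card Lin_kernel)"
    using card_zeros_le[OF \<chi>] by simp
  also have "\<dots> = (2 * card (zero_classes \<chi>)) * card Lin_kernel" by simp
  \<comment> \<open>The order of the common kernel bounds the class sizes and also enters the bound
    on the number of linear characters, so it cancels.\<close>
  finally have "card Lin * card Lin_kernel \<le> (2 * card (zero_classes \<chi>)) * card Lin_kernel"
    using card_Lin_le by (rule order_trans[rotated])
  then have "card Lin \<le> 2 * card (zero_classes \<chi>) \<or> card Lin_kernel = 0"
    by (simp only: mult_le_cancel2) auto
  then show ?thesis using Lin_kernel_props(3) by simp
qed

theorem anz_ge_third:
  assumes nonlinear: "\<chi> \<in> Irr G" "\<chi> \<one> \<noteq> 1"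
  shows "anz G \<ge> 1 / 3"
proof -
  define NL where "NL = Irr G - Lin"
  have fin: "finite NL" "finite Lin" using finite_Irr by (auto simp: NL_def Lin_def)
  have Irr_card: "card (Irr G) = card Lin + card NL"
    unfolding NL_def using finite_Irr by (subst card_Diff_subset) (auto simp: Lin_def card_mono)
  have \<chi>: "\<chi> \<in> NL" using nonlinear by (simp add: NL_def Lin_def)
  have zNL: "card (zero_classes \<psi>) \<ge> 1" if "\<psi> \<in> NL" for \<psi>
    using that card_zero_classes_ge_1 by (auto simp: NL_def Lin_def)
  have nz_NL: "nz G \<ge> (\<Sum>\<psi>\<in>NL. card (zero_classes \<psi>))"
    unfolding nz_eq NL_def using finite_Irr by (intro sum_mono2) auto
  moreover have "(\<Sum>\<psi>\<in>NL. card (zero_classes \<psi>)) \<ge> (\<Sum>\<psi>\<in>NL. 1)"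
    using zNL by (intro sum_mono) auto
  ultimately have nz_ge: "nz G \<ge> card NL" by simp
  have nz_ge': "2 * nz G \<ge> card Lin"
  proof (cases "inj_on (\<lambda>\<eta>. \<lambda>g\<in>carrier G. \<eta> g * \<chi> g) Lin")
    case True
    \<comment> \<open>Multiplying by a linear character keeps the degree, so the products stay
      nonlinear.\<close>
    moreover have "(\<lambda>\<eta>. \<lambda>g\<in>carrier G. \<eta> g * \<chi> g) ` Lin \<subseteq> NL"
      using Lin_times_Irr nonlinear by (auto simp: NL_def Lin_def)
    ultimately have "card Lin \<le> card NL" using fin card_inj_on_le by blast
    then show ?thesis using nz_ge by simp
  next
    case False
    then obtain \<eta> \<mu> where \<eta>: "\<eta> \<in> Lin" "\<mu> \<in> Lin" "\<eta> \<noteq> \<mu>"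
      and eq: "(\<lambda>g\<in>carrier G. \<eta> g * \<chi> g) = (\<lambda>g\<in>carrier G. \<mu> g * \<chi> g)"
      by (auto simp: inj_on_def)
    have "\<eta> g * \<chi> g = \<mu> g * \<chi> g" if "g \<in> carrier G" for g
      using fun_cong[OF eq, of g] that by simp
    then have "card Lin \<le> 2 * card (zero_classes \<chi>)"
      by (rule card_zero_classes_ge_Lin[OF nonlinear(1) \<eta>])
    moreover have "card (zero_classes \<chi>) \<le> nz G"
      using nz_NL member_le_sum[OF \<chi>, of "\<lambda>\<psi>. card (zero_classes \<psi>)"] fin by simp
    ultimately show ?thesis by simp
  qed
  have "card (Irr G) > 0" using finite_Irr nonlinear by (auto simp: card_gt_0_iff)
  \<comment> \<open>The nonlinear characters account for at most \<open>nz G\<close>, the linear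
    ones for at most \<open>2 * nz G\<close>.\<close>
  moreover have "card (Irr G) \<le> 3 * nz G" using nz_ge nz_ge' Irr_card by simp
  then have "real (card (Irr G)) \<le> 3 * real (nz G)" by linarith
  ultimately show ?thesis by (simp add: anz_def field_simps)
qed

end

section \<open>Nonlinear characters of noncommutative groups\<close>

interpretation fun_space: vector_space "\<lambda>c f (x :: 'a). c * f x :: complex"
  by unfold_locales (auto simp: fun_eq_iff algebra_simps)

lemma sum_fun_apply: "(\<Sum>i\<in>A. f i) x = (\<Sum>i\<in>A. f i x :: 'b :: comm_monoid_add)"
  by (induction A rule: infinite_finite_induct) auto

context group
begin

text \<open>This is the right regular representation; the value 0 off the carrier keeps the
  functions supported on the group.\<close>

definition translate :: "'a \<Rightarrow> ('a \<Rightarrow> complex) \<Rightarrow> 'a \<Rightarrow> complex" where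
  "translate x f = (\<lambda>g. if g \<in> carrier G then f (g \<otimes> x) else 0)"

lemma translate_mult:
  assumes "x \<in> carrier G" "y \<in> carrier G"
  shows "translate (x \<otimes> y) f = translate x (translate y f)"
  using assms by (auto simp: translate_def m_assoc)

lemma translate_combination:
  "translate x (\<Sum>i\<in>A. (\<lambda>g. c i * f i g)) = (\<Sum>i\<in>A. (\<lambda>g. c i * translate x (f i) g))"
  by (auto simp: fun_eq_iff translate_def sum_fun_apply)

text \<open>A nonzero subrepresentation of the regular representation is encoded by a basis, so that
  its dimension is a cardinality and can be minimised.\<close>

definition invariant_basis :: "('a \<Rightarrow> complex) set \<Rightarrow> bool" where
  "invariant_basis B \<longleftrightarrow> finite B \<and> B \<noteq> {} \<and> fun_space.independent B \<and>
     (\<forall>f\<in>fun_space.span B. \<forall>g. g \<notin> carrier G \<longrightarrow> f g = 0) \<and>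
     (\<forall>f\<in>fun_space.span B. \<forall>x\<in>carrier G. translate x f \<in> fun_space.span B)"

text \<open>Functions supported on the group lie in the span of the finitely many indicator
  functions of group elements.\<close>

lemma finite_basis_of_supported:
  assumes fin: "finite (carrier G)" and V: "fun_space.subspace V"
    and supp: "\<And>f g. f \<in> V \<Longrightarrow> g \<notin> carrier G \<Longrightarrow> f g = 0"
  obtains B where "finite B" "fun_space.independent B" "fun_space.span B = V"
proof -
  obtain B where B: "B \<subseteq> V" "fun_space.independent B" "V \<subseteq> fun_space.span B"
    using fun_space.maximal_independent_subset .
  define \<delta> where "\<delta> g = (\<lambda>x. if x = g then 1 else 0 :: complex)" for g :: 'a
  have "V \<subseteq> fun_space.span (\<delta> ` carrier G)"
  proof
    fix f assume f: "f \<in> V"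
    have "f = (\<Sum>g\<in>carrier G. (\<lambda>x. f g * \<delta> g x))"
    proof
      fix x
      have "(\<Sum>g\<in>carrier G. f g * \<delta> g x) = (\<Sum>g\<in>carrier G. if x = g then f g else 0)"
        by (intro sum.cong) (auto simp: \<delta>_def)
      also have "\<dots> = f x" using supp[OF f, of x] fin by auto
      finally show "f x = (\<Sum>g\<in>carrier G. (\<lambda>x. f g * \<delta> g x)) x" by (simp add: sum_fun_apply)
    qed
    also have "\<dots> \<in> fun_space.span (\<delta> ` carrier G)"
      by (intro fun_space.span_sum fun_space.span_scale fun_space.span_base) auto
    finally show "f \<in> fun_space.span (\<delta> ` carrier G)" .
  qed
  then have "finite B"
    using fun_space.independent_span_bound[of "\<delta> ` carrier G" B] B fin by blast
  moreover have "fun_space.span B = V" using B V by (intro fun_space.span_subspace)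
  ultimately show thesis using that B by blast
qed

text \<open>\<open>\<rho>\<close> is translation written in the coordinates of \<open>b\<close>. A
  nonzero invariant subspace \<open>W\<close> of column vectors corresponds to an invariant space of
  functions inside the span of \<open>B\<close>. By minimality its dimension is not smaller, so it
  is the whole span.\<close>

lemma minimal_invariant_basis_irreducible:
  assumes fin: "finite (carrier G)" and B: "invariant_basis B"
    and min: "\<And>B'. invariant_basis B' \<Longrightarrow> fun_space.span B' \<subseteq> fun_space.span B \<Longrightarrow> card B \<le> card B'"
    and b: "bij_betw b {..<card B} B"
  obtains \<rho> where "irreducible_rep G (card B) \<rho>"
    "\<And>x j. x \<in> carrier G \<Longrightarrow> j < card B \<Longrightarrow> translate x (b j) = (\<Sum>i<card B. (\<lambda>g. \<rho> x $$ (i, j) * b i g))"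
proof -
  define n where "n = card B"
  have finB: "finite B" and ind: "fun_space.independent B" and "B \<noteq> {}"
    and supp: "\<And>f g. f \<in> fun_space.span B \<Longrightarrow> g \<notin> carrier G \<Longrightarrow> f g = 0"
    and inv: "\<And>f x. f \<in> fun_space.span B \<Longrightarrow> x \<in> carrier G \<Longrightarrow> translate x f \<in> fun_space.span B"
    using B by (auto simp: invariant_basis_def)
  have n0: "n > 0" using finB \<open>B \<noteq> {}\<close> by (simp add: n_def card_gt_0_iff)
  have b: "bij_betw b {..<n} B" using b by (simp add: n_def)
  have b_span: "b j \<in> fun_space.span B" if "j < n" for j
    using that b by (intro fun_space.span_base) (auto simp: bij_betw_def)
  define \<rho> where "\<rho> x = mat n n (\<lambda>(i, j). fun_space.representation B (translate x (b j)) (b i))" for x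
  have \<rho>[simp]: "\<rho> x \<in> carrier_mat n n" for x by (simp add: \<rho>_def)
  \<comment> \<open>\<open>\<Phi>\<close> turns coordinate vectors into functions; it is a bijection
    onto the span of \<open>B\<close> that carries \<open>\<rho>\<close> to translation.\<close>
  define \<Phi> where "\<Phi> w = (\<Sum>i<n. (\<lambda>g. w $ i * b i g))" for w
  have expand: "f = (\<Sum>i<n. (\<lambda>g. fun_space.representation B f (b i) * b i g))"
    if "f \<in> fun_space.span B" for f
    using fun_space.sum_representation_eq[OF ind that finB subset_refl]
      sum.reindex_bij_betw[OF b, of "\<lambda>v. (\<lambda>g. fun_space.representation B f v * v g)"] by simp
  have \<Phi>_span: "\<Phi> w \<in> fun_space.span B" for w
    unfolding \<Phi>_def by (intro fun_space.span_sum fun_space.span_scale b_span) auto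
  have rep_\<Phi>: "fun_space.representation B (\<Phi> w) (b i) = w $ i" if "i < n" for w i
  proof -
    have "fun_space.representation B (\<Phi> w) (b i) =
        (\<Sum>j<n. fun_space.representation B (\<lambda>g. w $ j * b j g) (b i))"
      unfolding \<Phi>_def using b_span
      by (subst fun_space.representation_sum[OF ind]) (auto intro: fun_space.span_scale)
    also have "\<dots> = (\<Sum>j<n. w $ j * (if b i = b j then 1 else 0))"
    proof (intro sum.cong refl)
      fix j assume "j \<in> {..<n}"
      then have j: "j < n" "b j \<in> B" using b by (auto simp: bij_betw_def)
      show "fun_space.representation B (\<lambda>g. w $ j * b j g) (b i) = w $ j * (if b i = b j then 1 else 0)"
        using fun_space.representation_scale[OF ind b_span[OF j(1)], of "w $ j"]
          fun_space.representation_basis[OF ind j(2)] by simp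
    qed
    also have "\<dots> = (\<Sum>j<n. if i = j then w $ j else 0)"
      using b that by (intro sum.cong refl) (auto simp: bij_betw_def inj_on_def)
    also have "\<dots> = w $ i" using that by simp
    finally show ?thesis .
  qed
  have \<Phi>_inj: "v = w" if "v \<in> carrier_vec n" "w \<in> carrier_vec n" "\<Phi> v = \<Phi> w" for v w
    by (rule eq_vecI) (use that rep_\<Phi>[of _ v] rep_\<Phi>[of _ w] in auto)
  have \<Phi>_surj: "\<exists>w\<in>carrier_vec n. f = \<Phi> w" if "f \<in> fun_space.span B" for f
  proof
    show "f = \<Phi> (vec n (\<lambda>i. fun_space.representation B f (b i)))"
      by (subst expand[OF that]) (simp add: \<Phi>_def)
  qed simp
  have translate_b: "translate x (b j) = (\<Sum>i<n. (\<lambda>g. \<rho> x $$ (i, j) * b i g))"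
    if "x \<in> carrier G" "j < n" for x j
    by (subst expand[OF inv[OF b_span]]) (use that in \<open>auto simp: \<rho>_def intro!: sum.cong\<close>)
  have translate_\<Phi>: "translate x (\<Phi> w) = \<Phi> (\<rho> x *\<^sub>v w)" if x: "x \<in> carrier G" and w: "w \<in> carrier_vec n" for x w
  proof
    fix g
    have "translate x (\<Phi> w) g = (\<Sum>j<n. w $ j * (\<Sum>i<n. \<rho> x $$ (i, j) * b i g))"
      using x by (simp add: \<Phi>_def translate_combination translate_b sum_fun_apply)
    also have "\<dots> = (\<Sum>i<n. (\<Sum>j<n. \<rho> x $$ (i, j) * w $ j) * b i g)"
      unfolding sum_distrib_left sum_distrib_right by (subst sum.swap) (simp add: mult_ac)
    also have "\<dots> = \<Phi> (\<rho> x *\<^sub>v w) g"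
    proof -
      have "(\<rho> x *\<^sub>v w) $ i = (\<Sum>j<n. \<rho> x $$ (i, j) * w $ j)" if "i < n" for i
        using that w carrier_matD[OF \<rho>[of x]] by (simp add: scalar_prod_def lessThan_atLeast0)
      then show ?thesis by (simp add: \<Phi>_def sum_fun_apply)
    qed
    finally show "translate x (\<Phi> w) g = \<Phi> (\<rho> x *\<^sub>v w) g" .
  qed
  have \<rho>_mult: "\<rho> (x \<otimes> y) = \<rho> x * \<rho> y" if xy: "x \<in> carrier G" "y \<in> carrier G" for x y
  proof (rule mat_eqI_mult_vec)
    fix v :: "complex vec" assume v: "v \<in> carrier_vec n"
    have "\<Phi> (\<rho> (x \<otimes> y) *\<^sub>v v) = \<Phi> (\<rho> x *\<^sub>v (\<rho> y *\<^sub>v v))"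
      using xy v mult_mat_vec_carrier[OF \<rho> v]
      by (simp add: translate_\<Phi>[symmetric] translate_mult)
    then have "\<rho> (x \<otimes> y) *\<^sub>v v = \<rho> x *\<^sub>v (\<rho> y *\<^sub>v v)"
      using v mult_mat_vec_carrier[OF \<rho>] by (intro \<Phi>_inj) auto
    then show "\<rho> (x \<otimes> y) *\<^sub>v v = (\<rho> x * \<rho> y) *\<^sub>v v"
      using assoc_mult_mat_vec[OF \<rho> \<rho> v] by simp
  qed (rule \<rho> mult_carrier_mat[OF \<rho> \<rho>])+
  have \<rho>_one: "\<rho> \<one> = 1\<^sub>m n"
  proof (rule mat_eqI_mult_vec)
    fix v :: "complex vec" assume v: "v \<in> carrier_vec n"
    \<comment> \<open>On the carrier this is clear; off it both sides are 0 because of the support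
      condition.\<close>
    have "translate \<one> (\<Phi> v) = \<Phi> v"
      using supp[OF \<Phi>_span[of v]] by (auto simp: translate_def)
    then have "\<Phi> (\<rho> \<one> *\<^sub>v v) = \<Phi> v" using v by (simp add: translate_\<Phi>)
    then have "\<rho> \<one> *\<^sub>v v = v" using v mult_mat_vec_carrier[OF \<rho>] by (intro \<Phi>_inj) auto
    then show "\<rho> \<one> *\<^sub>v v = 1\<^sub>m n *\<^sub>v v" using v by simp
  qed auto
  have "irreducible_rep G n \<rho>"
    unfolding irreducible_rep_iff
  proof (intro conjI allI impI ballI \<rho>_mult \<rho>_one n0 \<rho>)
    fix W :: "complex vec set"
    assume W: "W \<subseteq> carrier_vec n" "0\<^sub>v n \<in> W" "\<forall>v\<in>W. \<forall>w\<in>W. v + w \<in> W" "\<forall>c. \<forall>v\<in>W. c \<cdot>\<^sub>v v \<in> W"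
      and inv_W: "\<forall>g\<in>carrier G. \<forall>w\<in>W. \<rho> g *\<^sub>v w \<in> W"
    show "W = {0\<^sub>v n} \<or> W = carrier_vec n"
    proof (cases "W = {0\<^sub>v n}")
      case False
      then obtain w where w: "w \<in> W" "w \<noteq> 0\<^sub>v n" using W(2) by blast
      have \<Phi>_0: "\<Phi> (0\<^sub>v n) = 0" by (auto simp: \<Phi>_def fun_eq_iff sum_fun_apply)
      have sub: "fun_space.subspace (\<Phi> ` W)"
      proof (rule fun_space.subspaceI)
        show "0 \<in> \<Phi> ` W" using \<Phi>_0 W(2) by force
      next
        fix x y assume "x \<in> \<Phi> ` W" "y \<in> \<Phi> ` W"
        then obtain v w where vw: "v \<in> W" "w \<in> W" "x = \<Phi> v" "y = \<Phi> w" by blast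
        then have "v \<in> carrier_vec n" "w \<in> carrier_vec n" using W(1) by auto
        then have "\<Phi> (v + w) = x + y"
          using vw by (auto simp: \<Phi>_def fun_eq_iff sum_fun_apply sum.distrib ring_distribs)
        then show "x + y \<in> \<Phi> ` W" using vw W(3) by force
      next
        fix c x assume "x \<in> \<Phi> ` W"
        then obtain v where v: "v \<in> W" "x = \<Phi> v" by blast
        then have vn: "v \<in> carrier_vec n" using W(1) by auto
        have "\<Phi> (c \<cdot>\<^sub>v v) = (\<lambda>g. c * x g)"
          unfolding v(2) \<Phi>_def sum_fun_apply sum_distrib_left
          by (rule ext, intro sum.cong refl) (use vn in simp)
        then show "(\<lambda>g. c * x g) \<in> \<Phi> ` W"
          using v W(4) by (intro image_eqI[of _ \<Phi> "c \<cdot>\<^sub>v v"]) auto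
      qed
      obtain B' where B': "finite B'" "fun_space.independent B'" "fun_space.span B' = \<Phi> ` W"
        using finite_basis_of_supported[OF fin sub] supp \<Phi>_span by blast
      have sub_B: "fun_space.span B' \<subseteq> fun_space.span B" using B'(3) \<Phi>_span by auto
      have "B' \<noteq> {}"
      proof
        assume "B' = {}"
        then have "\<Phi> w = 0" using B'(3) w(1) by auto
        then show False using \<Phi>_inj[of w "0\<^sub>v n"] w W(1) \<Phi>_0 by auto
      qed
      moreover have "translate x f \<in> fun_space.span B'" if f: "f \<in> fun_space.span B'" and x: "x \<in> carrier G" for f x
      proof -
        from f B'(3) obtain v where v: "v \<in> W" "f = \<Phi> v" by auto
        then have "translate x f = \<Phi> (\<rho> x *\<^sub>v v)" using x W(1) by (auto simp: translate_\<Phi>)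
        then show ?thesis using inv_W x v B'(3) by auto
      qed
      ultimately have "invariant_basis B'"
        using B' supp sub_B unfolding invariant_basis_def by blast
      then have card_le: "n \<le> card B'" using min sub_B by (simp add: n_def)
      \<comment> \<open>Any \<open>f\<close> outside could be added to \<open>B'\<close>, giving
        more than \<open>n\<close> independent vectors in a space spanned by
        \<open>n\<close>.\<close>
      have "fun_space.span B \<subseteq> fun_space.span B'"
      proof
        fix f assume f: "f \<in> fun_space.span B"
        show "f \<in> fun_space.span B'"
        proof (rule ccontr)
          assume nf: "f \<notin> fun_space.span B'"
          then have "fun_space.independent (insert f B')"
            using B'(2) by (intro fun_space.independent_insertI)
          moreover have "insert f B' \<subseteq> fun_space.span B"
            using f sub_B fun_space.span_superset[of B'] by blast
          ultimately have "card (insert f B') \<le> n"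
            using fun_space.independent_span_bound[OF finB] by (simp add: n_def)
          moreover have "f \<notin> B'" using nf fun_space.span_base by blast
          ultimately show False using card_le B'(1) by simp
        qed
      qed
      then have "v \<in> W" if v: "v \<in> carrier_vec n" for v
      proof -
        have "\<Phi> v \<in> \<Phi> ` W" using \<Phi>_span[of v] \<open>fun_space.span B \<subseteq> _\<close> B'(3) by auto
        then show ?thesis using \<Phi>_inj[OF v] W(1) by blast
      qed
      then show ?thesis using W(1) by auto
    qed simp
  qed
  then show thesis using that[of \<rho>] translate_b by (simp add: n_def)
qed

end

section \<open>Groups all of whose irreducible characters are linear\<close>

context finite_group
begin

text \<open>Otherwise the functions orthogonal to all linear characters form a nonzero space invariant
  under translation, and a minimal invariant subspace of it affords an irreducible character; this is
  linear and hence lies in the subspace itself, to which it is orthogonal.\<close>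
lemma commute_if_Irr_linear:
  assumes lin: "Irr G \<subseteq> Lin" and x: "x \<in> carrier G" and y: "y \<in> carrier G"
  shows "x \<otimes> y = y \<otimes> x"
proof (rule ccontr)
  assume neq: "x \<otimes> y \<noteq> y \<otimes> x"
  define V where "V = {f. (\<forall>g. g \<notin> carrier G \<longrightarrow> f g = 0) \<and>
    (\<forall>\<eta>\<in>Lin. (\<Sum>g\<in>carrier G. f g * cnj (\<eta> g)) = 0)}"
  have V_sub: "fun_space.subspace V"
    by (rule fun_space.subspaceI)
      (auto simp: V_def ring_distribs sum.distrib mult.assoc sum_distrib_left[symmetric])
  have V_inv: "translate z f \<in> V" if f: "f \<in> V" and z: "z \<in> carrier G" for z f
  proof -
    \<comment> \<open>As \<open>\<eta>\<close> is multiplicative, translating \<open>f\<close> only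
      multiplies its inner product with \<open>\<eta>\<close> by a constant.\<close>
    have "(\<Sum>g\<in>carrier G. translate z f g * cnj (\<eta> g)) = 0" if \<eta>: "\<eta> \<in> Lin" for \<eta>
    proof -
      have "(\<Sum>g\<in>carrier G. translate z f g * cnj (\<eta> g)) =
          (\<Sum>g\<in>carrier G. f (g \<otimes> z) * cnj (\<eta> g))" by (simp add: translate_def)
      also have "\<dots> = (\<Sum>g\<in>carrier G. f g * cnj (\<eta> (g \<otimes> inv z)))"
        by (rule sum.reindex_bij_witness[where i = "\<lambda>g. g \<otimes> inv z" and j = "\<lambda>g. g \<otimes> z"])
          (use z in \<open>auto simp: m_assoc\<close>)
      also have "\<dots> = (\<Sum>g\<in>carrier G. f g * cnj (\<eta> g)) * cnj (\<eta> (inv z))"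
        using z by (simp add: Lin_mult[OF \<eta>] sum_distrib_right mult.assoc)
      finally show ?thesis using f \<eta> by (simp add: V_def)
    qed
    then show ?thesis by (simp add: V_def translate_def)
  qed
  \<comment> \<open>Linear characters do not distinguish \<open>x \<otimes> y\<close> from
    \<open>y \<otimes> x\<close>, so this difference of indicator functions is orthogonal to them
    all; it is nonzero by \<open>neq\<close>.\<close>
  define h where "h = (\<lambda>g. (if g = x \<otimes> y then 1 else 0) - (if g = y \<otimes> x then 1 else 0 :: complex))"
  have "h \<in> V"
  proof -
    have "(\<Sum>g\<in>carrier G. h g * cnj (\<eta> g)) = 0" if \<eta>: "\<eta> \<in> Lin" for \<eta>
    proof -
      have "(\<Sum>g\<in>carrier G. h g * cnj (\<eta> g)) = (\<Sum>g\<in>carrier G. (if g = x \<otimes> y then cnj (\<eta> g) else 0)) -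
          (\<Sum>g\<in>carrier G. (if g = y \<otimes> x then cnj (\<eta> g) else 0))"
        unfolding sum_subtractf[symmetric] by (intro sum.cong refl) (auto simp: h_def)
      also have "\<dots> = cnj (\<eta> (x \<otimes> y)) - cnj (\<eta> (y \<otimes> x))"
        using x y finite_carrier by simp
      finally show ?thesis using x y by (simp add: Lin_mult[OF \<eta>] mult.commute)
    qed
    then show ?thesis using x y by (auto simp: V_def h_def)
  qed
  have "h \<noteq> 0"
  proof
    assume "h = 0"
    then have "h (x \<otimes> y) = 0" by simp
    then show False using neq by (simp add: h_def)
  qed
  define P where "P B \<longleftrightarrow> invariant_basis B \<and> fun_space.span B \<subseteq> V" for B
  obtain B0 where B0: "finite B0" "fun_space.independent B0" "fun_space.span B0 = V"
    using finite_basis_of_supported[OF finite_carrier V_sub] by (auto simp: V_def)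
  have "B0 \<noteq> {}" using B0(3) \<open>h \<in> V\<close> \<open>h \<noteq> 0\<close> by auto
  then have "P B0"
    unfolding P_def invariant_basis_def B0(3) using B0(1,2) V_inv by (auto simp: V_def)
  \<comment> \<open>A basis of least cardinality within \<open>V\<close> is also least among those
    inside its own span, which is what irreducibility requires.\<close>
  then obtain B where B: "P B" and min: "\<And>B'. P B' \<Longrightarrow> card B \<le> card B'"
    using ex_has_least_nat[of P B0 card] by blast
  have "finite B" using B by (simp add: P_def invariant_basis_def)
  then obtain b where b: "bij_betw b {..<card B} B"
    using ex_bij_betw_nat_finite by (metis lessThan_atLeast0)
  obtain \<rho> where \<rho>: "irreducible_rep G (card B) \<rho>"
    and tr: "\<And>x j. x \<in> carrier G \<Longrightarrow> j < card B \<Longrightarrow>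
      translate x (b j) = (\<Sum>i<card B. (\<lambda>g. \<rho> x $$ (i, j) * b i g))"
    using minimal_invariant_basis_irreducible[OF finite_carrier _ _ b] B min unfolding P_def by blast
  define \<chi> where "\<chi> = character G \<rho>"
  have \<chi>: "\<chi> \<in> Lin" using lin \<rho> by (auto simp: \<chi>_def Irr_def)
  \<comment> \<open>The value of \<open>\<chi>\<close> at \<open>\<one>\<close> is the dimension, so
    the minimal space is a line.\<close>
  have "of_nat (card B) = (1 :: complex)"
    using \<chi> character_eq[OF \<rho>, of \<one>] irreducible_repD(3)[OF \<rho>] by (simp add: \<chi>_def Lin_def)
  then have card1: "card B = 1" by simp
  then have bB: "b 0 \<in> B" using b by (auto simp: bij_betw_def)
  then have "b 0 \<in> V" using B fun_space.span_base by (auto simp: P_def)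
  \<comment> \<open>Evaluating the translate of \<open>b 0\<close> by \<open>g\<close> at
    \<open>\<one>\<close> shows that \<open>b 0\<close> is a multiple of \<open>\<chi>\<close>, to
    which it is orthogonal as a member of \<open>V\<close>.\<close>
  have b0: "b 0 g = \<chi> g * b 0 \<one>" if g: "g \<in> carrier G" for g
  proof -
    have "translate g (b 0) \<one> = \<rho> g $$ (0, 0) * b 0 \<one>"
      using tr[OF g, of 0] card1 by (simp add: sum_fun_apply)
    then show ?thesis
      using g card1 character_eq[OF \<rho> g] by (simp add: translate_def \<chi>_def)
  qed
  have "0 = (\<Sum>g\<in>carrier G. b 0 g * cnj (\<chi> g))"
    using \<open>b 0 \<in> V\<close> \<chi> by (simp add: V_def)
  also have "\<dots> = (\<Sum>g\<in>carrier G. b 0 \<one>)"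
  proof (intro sum.cong refl)
    fix g assume g: "g \<in> carrier G"
    have "b 0 g * cnj (\<chi> g) = (\<chi> g * cnj (\<chi> g)) * b 0 \<one>"
      using b0[OF g] by (simp only: mult_ac)
    then show "b 0 g * cnj (\<chi> g) = b 0 \<one>" using Lin_mult_cnj[OF \<chi> g] by simp
  qed
  finally have "b 0 \<one> = 0" using card_carrier_gt_0 by simp
  then have "b 0 g = 0" if "g \<in> carrier G" for g using b0[OF that] by simp
  then have "b 0 = 0" using \<open>b 0 \<in> V\<close> by (auto simp: V_def fun_eq_iff)
  then show False
    using bB B fun_space.dependent_zero[of B] by (auto simp: P_def invariant_basis_def)
qed

lemma commutative_nilpotent:
  assumes comm: "\<And>x y. x \<in> carrier G \<Longrightarrow> y \<in> carrier G \<Longrightarrow> x \<otimes> y = y \<otimes> x"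
  shows "nilpotent G"
proof -
  have "h \<otimes> k \<otimes> inv h \<otimes> inv k = \<one>" if "h \<in> carrier G" "k \<in> carrier G" for h k
    using that comm[of h k] by (simp add: m_assoc inv_mult_group[symmetric])
  then have "{h \<otimes> k \<otimes> inv h \<otimes> inv k | h k. h \<in> carrier G \<and> k \<in> carrier G} = {\<one>}" by force
  then have "lower_central_series G 1 = {\<one>}"
    by (simp add: commutator_subgroup_def generate_one)
  then show ?thesis unfolding nilpotent_def by blast
qed

end

theorem theoremD:
  fixes G (structure)
  assumes "group G"
    and "finite (carrier G)"
    and "anz G < 1 / 3"
  shows "nilpotent G"
proof -
  interpret finite_group G
    using assms by (simp add: finite_group_def finite_group_axioms_def)
  have "Irr G \<subseteq> Lin"
    using anz_ge_third assms(3) by (force simp: Lin_def)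
  then show ?thesis using commute_if_Irr_linear commutative_nilpotent by blast
qed

end
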